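(* Let $k\ge 2$ and let $\{S_n\}_{n\ge 0}\subset\mathsf{Aut}_0(\mathbb{C}^k)$ be any sequence of automorphisms that satisfies the uniform upper-bound condition at the origin. Then there exists a biholomorphism $\Phi$ from $\Omega_{\{S_n\}}$ onto its image in $\mathbb{C}^k$ such that the Hausdorff dimension of the boundary of $\Phi(\Omega_{\{S_n\}})$ at any of its points is $2k$.
   Context: $\mathsf{Aut}_0(\mathbb{C}^k)$ denotes the group of (holomorphic) automorphisms of $\mathbb{C}^k$ fixing the origin, and $B^k(p;r)$ is the ball of radius $r$ centered at $p$ in $\mathbb{C}^k$. For a sequence $\{S_n\}_{n\ge 0}\subset \mathsf{Aut}_0(\mathbb{C}^k)$ put $S(n)=S_n\circ\cdots\circ S_0$; the (non-autonomous) basin of attraction at the origin is $\Omega_{\{S_n\}}=\{z\in\mathbb{C}^k: S(n)(z)\to 0 \text{ as } n\to\infty\}$. A sequence $\{S_n\}\subset\mathsf{Aut}_0(\mathbb{C}^k)$ satisfies the uniform upper-bound condition at the origin if there exist $r>0$ and $0<C<1$ such that $\|S_n(z)\|\le C\|z\|$ for every $z\in B^k(0;r)$ and every $n\ge 0$. The Hausdorff dimension of a set $X\subset\mathbb{C}^k$ at a point $p\in X$ is $2k$ if $X\cap B^k(p;\epsilon)$ has Hausdorff dimension $2k$ for every $\epsilon>0$. *)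

theory Defs
  imports "HOL-Analysis.Analysis"
begin

text \<open>
  The derivative of the library is real-linear, so complex linearity is required separately.
  The notion is only used on open sets, where it is complex differentiability at every point.
\<close>

definition holomorphic_map_on ::
  "(complex ^ 'k \<Rightarrow> complex ^ 'm) \<Rightarrow> (complex ^ 'k) set \<Rightarrow> bool" where
  "holomorphic_map_on f U \<longleftrightarrow>
    (\<forall>z\<in>U. \<exists>f'. Vector_Spaces.linear (*s) (*s) f' \<and> (f has_derivative f') (at z within U))"

definition biholomorphism ::
  "(complex ^ 'k \<Rightarrow> complex ^ 'k) \<Rightarrow> (complex ^ 'k) set \<Rightarrow> (complex ^ 'k) set \<Rightarrow> bool" where
  "biholomorphism f U V \<longleftrightarrow>
    open U \<and> open V \<and> bij_betw f U V \<and>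
    holomorphic_map_on f U \<and> holomorphic_map_on (inv_into U f) V"

definition Aut0 :: "(complex ^ 'k \<Rightarrow> complex ^ 'k) set" where
  "Aut0 = {f. biholomorphism f UNIV UNIV \<and> f 0 = 0}"

primrec comp_upto :: "(nat \<Rightarrow> 'a \<Rightarrow> 'a) \<Rightarrow> nat \<Rightarrow> 'a \<Rightarrow> 'a" where
  "comp_upto S 0 = S 0"
| "comp_upto S (Suc n) = S (Suc n) \<circ> comp_upto S n"

definition basin :: "(nat \<Rightarrow> complex ^ 'k \<Rightarrow> complex ^ 'k) \<Rightarrow> (complex ^ 'k) set" where
  "basin S = {z. (\<lambda>n. comp_upto S n z) \<longlonglongrightarrow> 0}"

definition uniform_upper_bound :: "(nat \<Rightarrow> complex ^ 'k \<Rightarrow> complex ^ 'k) \<Rightarrow> bool" where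
  "uniform_upper_bound S \<longleftrightarrow>
    (\<exists>r>0. \<exists>C. 0 < C \<and> C < 1 \<and> (\<forall>n. \<forall>z\<in>ball 0 r. norm (S n z) \<le> C * norm z))"

text \<open>
  The \<open>s\<close>-th power of the diameter, with \<open>diam(U)\<^sup>0 = 1\<close> for nonempty \<open>U\<close>; note that
  \<open>0 powr 0 = 0\<close>. The empty set gets weight \<open>0\<close>, so that sequences of covering sets also
  account for finite covers.
\<close>

definition diam_power :: "real \<Rightarrow> 'a::metric_space set \<Rightarrow> ennreal" where
  "diam_power s U =
    (if U = {} then 0 else if s = 0 then 1 else ennreal (diameter U powr s))"

text \<open>Boundedness is required because \<open>diameter\<close> is unspecified on unbounded sets.\<close>

definition hausdorff_premeasure :: "real \<Rightarrow> real \<Rightarrow> 'a::metric_space set \<Rightarrow> ennreal" where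
  "hausdorff_premeasure s \<delta> A =
    (INF U\<in>{U :: nat \<Rightarrow> 'a set.
              A \<subseteq> (\<Union>i. U i) \<and> (\<forall>i. bounded (U i) \<and> diameter (U i) \<le> \<delta>)}.
       \<Sum>i. diam_power s (U i))"

definition hausdorff_measure :: "real \<Rightarrow> 'a::metric_space set \<Rightarrow> ennreal" where
  "hausdorff_measure s A = (SUP \<delta>\<in>{0<..}. hausdorff_premeasure s \<delta> A)"

definition hausdorff_dim :: "'a::metric_space set \<Rightarrow> ereal" where
  "hausdorff_dim A = (INF s\<in>{s. 0 \<le> s \<and> hausdorff_measure s A = 0}. ereal s)"

definition full_hausdorff_dim_at :: "(complex ^ 'k) set \<Rightarrow> complex ^ 'k \<Rightarrow> bool" where
  "full_hausdorff_dim_at X p \<longleftrightarrow>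
    (\<forall>\<epsilon>>0. hausdorff_dim (X \<inter> ball p \<epsilon>) = ereal (2 * real CARD('k)))"

end

theory Submission
  imports Defs "HOL-Complex_Analysis.Complex_Analysis"
begin

text \<open>
  The basin \<open>\<Omega>\<close> is exhausted by compact sets \<open>K\<^sub>n\<close>, the preimages of a closed polydisc under
  global automorphisms \<open>G\<^sub>n\<close>. A push-out construction yields \<open>\<Phi>\<close> as the limit of inverses of
  automorphisms \<open>F\<^sub>n\<close>, where \<open>F\<^sub>n\<^sub>+\<^sub>1 = C\<^sub>n \<circ> F\<^sub>n\<close> and both \<open>C\<^sub>n\<close> and its inverse are very close to
  the identity on \<open>K\<^sub>n\<close>; then \<open>\<Phi>(\<Omega>)\<close> is the increasing union of the sets \<open>F\<^sub>n\<^sup>-\<^sup>1(K\<^sub>n)\<close>.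
  The automorphism \<open>C\<^sub>n\<close> is chosen so that passing from \<open>F\<^sub>n\<^sup>-\<^sup>1(K\<^sub>n)\<close> to
  \<open>F\<^sub>n\<^sub>+\<^sub>1\<^sup>-\<^sup>1(K\<^sub>n\<^sub>+\<^sub>1)\<close> adds only a set of tiny Lebesgue measure inside a large ball, yet
  meets the \<open>n\<close>-th set of a countable basis of the topology. Hence \<open>\<Phi>(\<Omega>)\<close> is dense, its
  boundary is its complement, and the complement has positive measure near each of its points,
  which forces full Hausdorff dimension.

  In the coordinates of \<open>G\<^sub>n\<close> the map \<open>C\<^sub>n\<close> is a composition of shears built from high powers of
  coordinates: \<open>(\<zeta> / \<rho>)\<^sup>N\<close> is tiny for \<open>\<bar>\<zeta>\<bar> < \<rho>\<close> and huge for \<open>\<bar>\<zeta>\<bar> > \<rho>\<close>, and the transition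
  takes place in a thin annulus, which accounts for the exceptional sets of small measure.
\<close>

no_notation fps_nth (infixl "$" 75)

section \<open>Holomorphic maps and automorphisms\<close>

lemma norm_vector_smult: "norm (t *s v) = norm t * norm v"
  for t :: complex and v :: "complex ^ 'k"
  by (simp add: norm_vec_def norm_mult L2_set_right_distrib)

text \<open>Supplies the limit and derivative rules for complex scalar multiplication.\<close>

lemma bounded_bilinear_vector_smult:
  "bounded_bilinear ((*s) :: complex \<Rightarrow> complex ^ 'k \<Rightarrow> complex ^ 'k)"
proof
  show "\<exists>K. \<forall>a b. norm ((a::complex) *s (b :: complex ^ 'k)) \<le> norm a * norm b * K"
    by (rule exI[of _ 1]) (simp add: norm_vector_smult)
qed (auto simp: vec_eq_iff algebra_simps)

lemma holomorphic_map_on_imp_continuous_on: "holomorphic_map_on f U \<Longrightarrow> continuous_on U f"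
  unfolding holomorphic_map_on_def continuous_on_eq_continuous_within
  using has_derivative_continuous by blast

lemma holomorphic_map_on_imp_differentiable_on: "holomorphic_map_on f U \<Longrightarrow> f differentiable_on U"
  unfolding holomorphic_map_on_def differentiable_on_def differentiable_def by blast

lemma linear_smult_iff:
  fixes f :: "complex ^ 'a \<Rightarrow> complex ^ 'b"
  shows "Vector_Spaces.linear (*s) (*s) f \<longleftrightarrow>
    (\<forall>x y. f (x + y) = f x + f y) \<and> (\<forall>c x. f (c *s x) = c *s f x)"
  by (simp add: Vector_Spaces.linear_iff vec.vector_space_axioms)

lemma linear_smult_compose:
  fixes f :: "complex ^ 'a \<Rightarrow> complex ^ 'b" and g :: "complex ^ 'b \<Rightarrow> complex ^ 'c"
  assumes "Vector_Spaces.linear (*s) (*s) f" "Vector_Spaces.linear (*s) (*s) g"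
  shows "Vector_Spaces.linear (*s) (*s) (g \<circ> f)"
  using assms Vector_Spaces.linear_compose by blast

lemma holomorphic_map_on_compose:
  assumes "holomorphic_map_on f U" "holomorphic_map_on g V" "f ` U \<subseteq> V"
  shows "holomorphic_map_on (g \<circ> f) U"
  unfolding holomorphic_map_on_def
proof
  fix z assume z: "z \<in> U"
  obtain f' where f': "Vector_Spaces.linear (*s) (*s) f'" "(f has_derivative f') (at z within U)"
    using assms(1) z unfolding holomorphic_map_on_def by blast
  have "f z \<in> V" using assms(3) z by blast
  then obtain g' where g': "Vector_Spaces.linear (*s) (*s) g'"
      "(g has_derivative g') (at (f z) within V)"
    using assms(2) unfolding holomorphic_map_on_def by blast
  have "(g has_derivative g') (at (f z) within f ` U)"
    using g'(2) assms(3) by (rule has_derivative_subset)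
  then have "(g \<circ> f has_derivative g' \<circ> f') (at z within U)"
    by (rule diff_chain_within[OF f'(2)])
  moreover have "Vector_Spaces.linear (*s) (*s) (g' \<circ> f')"
    using f'(1) g'(1) by (rule linear_smult_compose)
  ultimately show "\<exists>D. Vector_Spaces.linear (*s) (*s) D \<and> (g \<circ> f has_derivative D) (at z within U)"
    by blast
qed

section \<open>Automorphisms: inverses, composition, preimages\<close>

abbreviation automorphism :: "(complex ^ 'k \<Rightarrow> complex ^ 'k) \<Rightarrow> bool" where
  "automorphism f \<equiv> biholomorphism f UNIV UNIV"

lemma automorphismI:
  assumes "holomorphic_map_on f UNIV" "holomorphic_map_on g UNIV"
    and "\<And>z. g (f z) = z" "\<And>z. f (g z) = z"
  shows "automorphism f" "inv f = g"
proof -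
  show inv: "inv f = g"
    using assms(3,4) by (intro inv_unique_comp) auto
  have "bij f"
    using assms(3,4) by (intro o_bij[of g]) auto
  then show "automorphism f"
    unfolding biholomorphism_def using assms(1,2) inv by simp
qed

lemma
  assumes "automorphism f"
  shows automorphism_bij: "bij f"
    and automorphism_holomorphic: "holomorphic_map_on f UNIV"
    and automorphism_inv_holomorphic: "holomorphic_map_on (inv f) UNIV"
  using assms unfolding biholomorphism_def by auto

lemma automorphism_inv_f [simp]: "automorphism f \<Longrightarrow> inv f (f z) = z"
  by (simp add: automorphism_bij bij_is_inj)

lemma automorphism_f_inv [simp]: "automorphism f \<Longrightarrow> f (inv f z) = z"
  by (meson automorphism_bij bij_inv_eq_iff)

lemma automorphism_inv: "automorphism f \<Longrightarrow> automorphism (inv f)"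
  by (rule automorphismI(1)[of _ f])
     (auto simp: automorphism_holomorphic automorphism_inv_holomorphic)

lemma automorphism_inv_inv [simp]: "automorphism f \<Longrightarrow> inv (inv f) = f"
  by (simp add: automorphism_bij inv_inv_eq)

lemma
  assumes "automorphism f" "automorphism g"
  shows automorphism_compose: "automorphism (g \<circ> f)"
    and inv_automorphism_compose: "inv (g \<circ> f) = inv f \<circ> inv g"
proof -
  have 1: "holomorphic_map_on (g \<circ> f) UNIV" "holomorphic_map_on (inv f \<circ> inv g) UNIV"
    using assms
    by (auto intro: holomorphic_map_on_compose automorphism_holomorphic automorphism_inv_holomorphic)
  show "automorphism (g \<circ> f)" "inv (g \<circ> f) = inv f \<circ> inv g"
    using automorphismI[OF 1] assms by auto
qed

lemma holomorphic_map_on_id: "holomorphic_map_on (\<lambda>z. z) U"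
  unfolding holomorphic_map_on_def
  by (auto intro!: exI[of _ "\<lambda>z. z"] simp: linear_smult_iff)

lemma automorphism_id: "automorphism (\<lambda>z. z)"
  by (rule automorphismI(1)[of _ "\<lambda>z. z"]) (auto simp: holomorphic_map_on_id)

lemma automorphism_continuous_on: "automorphism f \<Longrightarrow> continuous_on U f"
  by (meson automorphism_holomorphic continuous_on_subset holomorphic_map_on_imp_continuous_on subset_UNIV)

lemma compact_vimage_automorphism:
  assumes "automorphism f" "compact K"
  shows "compact (f -` K)"
proof -
  have "f -` K = inv f ` K"
    using assms(1) by (simp add: automorphism_bij bij_vimage_eq_inv_image)
  then show ?thesis
    using assms by (metis automorphism_continuous_on automorphism_inv compact_continuous_image)
qed

lemma open_vimage_automorphism: "automorphism f \<Longrightarrow> open U \<Longrightarrow> open (f -` U)"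
  by (simp add: automorphism_continuous_on open_vimage)

lemma negligible_vimage_automorphism:
  assumes "automorphism f" "negligible S"
  shows "negligible (f -` S)"
proof -
  have "f -` S = inv f ` S"
    using assms(1) by (simp add: automorphism_bij bij_vimage_eq_inv_image)
  moreover have "inv f differentiable_on S"
    by (meson assms(1) automorphism_inv_holomorphic differentiable_on_subset
        holomorphic_map_on_imp_differentiable_on subset_UNIV)
  ultimately show ?thesis
    using assms(2) by (simp add: negligible_differentiable_image_negligible)
qed

text \<open>As \<open>\<rho>\<close> is positive, each ray from the origin meets the set in at most
  one point.\<close>

lemma negligible_norm_nth_eq:
  assumes "0 < \<rho>"
  shows "negligible {z :: complex ^ 'k. norm (z $ j) = \<rho>}"
proof (rule starlike_negligible[where a = 0])
  show "closed {z :: complex ^ 'k. norm (z $ j) = \<rho>}"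
    by (intro closed_Collect_eq continuous_intros)
qed (use assms in auto)

section \<open>Polynomial shears\<close>

definition power_shear ::
  "'k set \<Rightarrow> ('k \<Rightarrow> complex) \<Rightarrow> ('k \<Rightarrow> nat) \<Rightarrow> complex ^ 'k \<Rightarrow> complex ^ 'k \<Rightarrow> complex ^ 'k" where
  "power_shear J c N v z = z + (\<Sum>j\<in>J. c j * (z $ j) ^ N j) *s v"

lemma holomorphic_power_shear:
  fixes v :: "complex ^ 'k"
  shows "holomorphic_map_on (power_shear J c N v) U"
  unfolding holomorphic_map_on_def
proof
  fix z :: "complex ^ 'k"
  let ?D = "\<lambda>h. h + (\<Sum>j\<in>J. c j * (of_nat (N j) * h $ j * (z $ j) ^ (N j - 1))) *s v"
  have "((\<lambda>z. (\<Sum>j\<in>J. c j * (z $ j) ^ N j)) has_derivative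
      (\<lambda>h. \<Sum>j\<in>J. c j * (of_nat (N j) * h $ j * (z $ j) ^ (N j - 1)))) (at z within U)"
    by (rule has_derivative_eq_rhs, (rule derivative_intros bounded_linear.has_derivative[OF bounded_linear_vec_nth])+)
       (auto simp: fun_eq_iff)
  then have "(power_shear J c N v has_derivative ?D) (at z within U)"
    unfolding power_shear_def
    by (intro has_derivative_add has_derivative_ident
        bounded_linear.has_derivative[OF bounded_bilinear.bounded_linear_left[OF bounded_bilinear_vector_smult]])
  moreover have "Vector_Spaces.linear (*s) (*s) ?D"
    by (auto simp: linear_smult_iff vec_eq_iff algebra_simps sum.distrib sum_distrib_left
        sum_distrib_right)
  ultimately show "\<exists>f'. Vector_Spaces.linear (*s) (*s) f' \<and>
      (power_shear J c N v has_derivative f') (at z within U)"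
    by blast
qed

text \<open>The displacement is a multiple of \<open>v\<close>, so the coordinates in
  \<open>J\<close> do not change and the sum has the same value before and after the shear;
  subtracting it undoes the map.\<close>

lemma
  fixes v :: "complex ^ 'k"
  assumes "\<And>j. j \<in> J \<Longrightarrow> v $ j = 0"
  shows automorphism_power_shear: "automorphism (power_shear J c N v)"
    and inv_power_shear: "inv (power_shear J c N v) = power_shear J c N (- v)"
proof -
  have nth: "power_shear J c N u z $ j = z $ j" if "j \<in> J" "u = v \<or> u = - v" for u z j
    using that assms by (auto simp: power_shear_def)
  have "power_shear J c N (- v) (power_shear J c N v z) = z"
    and "power_shear J c N v (power_shear J c N (- v) z) = z" for z
    by (subst power_shear_def, simp add: nth, simp add: power_shear_def vec_eq_iff)+
  then show "automorphism (power_shear J c N v)" "inv (power_shear J c N v) = power_shear J c N (- v)"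
    using automorphismI[OF holomorphic_power_shear holomorphic_power_shear] by blast+
qed

section \<open>Locally uniform limits\<close>

lemma norm_le_sum_norm_nth: "norm x \<le> (\<Sum>i\<in>UNIV. norm (x $ i))"
  for x :: "'a::real_normed_vector ^ 'k"
  by (simp add: norm_vec_def L2_set_le_sum)

text \<open>Each component of \<open>g\<close>, restricted to the complex line through
  \<open>z\<close> in direction \<open>h\<close>, is a function of one variable with derivative
  \<open>D h $ i\<close> at 0, to which the classical Cauchy inequality applies. Summing over the
  components gives the factor \<open>CARD('m)\<close>.\<close>

lemma cauchy_estimate_derivative:
  fixes g :: "complex ^ 'k \<Rightarrow> complex ^ 'm"
  assumes hol: "holomorphic_map_on g (ball z \<rho>)" and "0 < \<rho>"
    and D: "(g has_derivative D) (at z)"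
    and B: "\<And>w. w \<in> ball z \<rho> \<Longrightarrow> norm (g w) \<le> B"
  shows "norm (D h) \<le> real CARD('m) * (2 * B / \<rho>) * norm h"
proof (cases "h = 0")
  case True
  interpret bounded_linear D using D by (rule has_derivative_bounded_linear)
  show ?thesis using True zero by simp
next
  case False
  \<comment> \<open>Half of the limiting radius, so that the closed disc of radius \<open>r\<close>
    is mapped into the open ball.\<close>
  define r where "r = \<rho> / (2 * norm h)"
  have r: "0 < r" using False assms(2) by (simp add: r_def)
  have in_ball: "z + t *s h \<in> ball z \<rho>" if "norm t \<le> r" for t
  proof -
    have "norm (t *s h) \<le> r * norm h"
      using that by (simp add: norm_vector_smult mult_right_mono)
    also have "\<dots> < \<rho>" using False assms(2) by (simp add: r_def)
    finally show ?thesis by (simp add: dist_norm)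
  qed
  have line: "((\<lambda>t. z + t *s h) has_derivative (\<lambda>s. s *s h)) (at t)" for t
    using has_derivative_add[OF has_derivative_const bounded_linear_imp_has_derivative[OF
        bounded_bilinear.bounded_linear_left[OF bounded_bilinear_vector_smult]]]
    by simp
  have deriv: "((\<lambda>t. g (z + t *s h) $ i) has_field_derivative E h $ i) (at t)"
    if "(g has_derivative E) (at (z + t *s h))" "Vector_Spaces.linear (*s) (*s) E" for t i E
  proof -
    have "((\<lambda>t. g (z + t *s h)) has_derivative (\<lambda>s. E (s *s h))) (at t)"
      using has_derivative_compose[OF line that(1)] .
    then have "((\<lambda>t. g (z + t *s h) $ i) has_derivative (\<lambda>s. E (s *s h) $ i)) (at t)"
      by (rule bounded_linear.has_derivative[OF bounded_linear_vec_nth])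
    moreover have "(\<lambda>s. E (s *s h) $ i) = (*) (E h $ i)"
      using that(2) by (auto simp: linear_smult_iff)
    ultimately show ?thesis by (simp add: has_field_derivative_def)
  qed
  have hol_at: "\<exists>E. Vector_Spaces.linear (*s) (*s) E \<and> (g has_derivative E) (at w)"
    if "w \<in> ball z \<rho>" for w
    using hol that at_within_open[OF that open_ball] unfolding holomorphic_map_on_def by metis
  have "norm (D h $ i) \<le> B / r" for i
  proof -
    let ?\<phi> = "\<lambda>t. g (z + t *s h) $ i"
    have diff: "?\<phi> field_differentiable (at t)" if "norm t \<le> r" for t
      using hol_at[OF in_ball[OF that]] deriv field_differentiable_def by blast
    have "norm ((deriv ^^ 1) ?\<phi> 0) \<le> fact 1 * B / r ^ 1"
    proof (rule Cauchy_inequality)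
      show "?\<phi> holomorphic_on ball 0 r"
        by (auto simp: holomorphic_on_def intro!: field_differentiable_at_within diff)
      show "continuous_on (cball 0 r) ?\<phi>"
        by (auto intro!: continuous_at_imp_continuous_on field_differentiable_imp_continuous_at diff)
      show "norm (?\<phi> t) \<le> B" if "norm (0 - t) = r" for t
        using B[OF in_ball] that
        by (metis Finite_Cartesian_Product.norm_nth_le diff_0 norm_minus_cancel order_refl order_trans)
    qed (use r in auto)
    moreover have "deriv ?\<phi> 0 = D h $ i"
    proof -
      obtain E where E: "Vector_Spaces.linear (*s) (*s) E" "(g has_derivative E) (at z)"
        using hol_at[of z] assms(2) by auto
      then have "E = D" using D has_derivative_unique by blast
      then show ?thesis using deriv[of D 0 i] E by (intro DERIV_imp_deriv) auto
    qed
    ultimately show ?thesis by simp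
  qed
  then have "norm (D h) \<le> (\<Sum>i\<in>(UNIV::'m set). B / r)"
    by (intro order_trans[OF norm_le_sum_norm_nth] sum_mono) auto
  also have "\<dots> = real CARD('m) * (2 * B / \<rho>) * norm h"
    using False by (simp add: r_def)
  finally show ?thesis .
qed

lemma holomorphic_map_on_diff:
  assumes "holomorphic_map_on f U" "holomorphic_map_on g U"
  shows "holomorphic_map_on (\<lambda>z. f z - g z) U"
  unfolding holomorphic_map_on_def
proof
  fix z assume "z \<in> U"
  then obtain f' g' where
    "Vector_Spaces.linear (*s) (*s) f'" "(f has_derivative f') (at z within U)"
    "Vector_Spaces.linear (*s) (*s) g'" "(g has_derivative g') (at z within U)"
    using assms unfolding holomorphic_map_on_def by meson
  then show "\<exists>D. Vector_Spaces.linear (*s) (*s) D \<and> ((\<lambda>z. f z - g z) has_derivative D) (at z within U)"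
    by (intro exI[of _ "\<lambda>h. f' h - g' h"])
       (auto simp: linear_smult_iff vector_ssub_ldistrib intro: has_derivative_diff)
qed

lemma holomorphic_map_on_subset: "holomorphic_map_on f U \<Longrightarrow> V \<subseteq> U \<Longrightarrow> holomorphic_map_on f V"
  unfolding holomorphic_map_on_def by (meson has_derivative_subset subsetD)

text \<open>Weierstrass: the Cauchy estimate turns a uniform Cauchy condition on the maps into one
  on their derivatives, so the derivatives converge too and the limit is differentiable. Complex
  linearity survives the pointwise limit of the derivatives.\<close>

lemma holomorphic_map_on_uniform_limit:
  fixes f :: "nat \<Rightarrow> complex ^ 'k \<Rightarrow> complex ^ 'm"
  assumes "open U" and hol: "\<And>n. holomorphic_map_on (f n) U"
    and lim: "\<And>z. z \<in> U \<Longrightarrow> \<exists>\<delta>>0. uniform_limit (ball z \<delta>) f g sequentially"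
  shows "holomorphic_map_on g U"
  unfolding holomorphic_map_on_def
proof
  fix z assume z: "z \<in> U"
  obtain \<delta>1 where \<delta>1: "\<delta>1 > 0" "uniform_limit (ball z \<delta>1) f g sequentially"
    using lim[OF z] by blast
  obtain \<delta>2 where \<delta>2: "\<delta>2 > 0" "ball z \<delta>2 \<subseteq> U"
    using \<open>open U\<close> z open_contains_ball by blast
  \<comment> \<open>Balls of radius \<open>\<rho>\<close> about points of
    \<open>ball z \<rho>\<close> stay in \<open>ball z (2 * \<rho>)\<close>, where the convergence
    is uniform; this is the room for the Cauchy estimate.\<close>
  define \<rho> where "\<rho> = min \<delta>1 \<delta>2 / 2"
  have \<rho>: "0 < \<rho>" using \<delta>1 \<delta>2 by (simp add: \<rho>_def)
  have big: "ball z (2 * \<rho>) \<subseteq> U" "uniform_limit (ball z (2 * \<rho>)) f g sequentially"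
    using \<delta>1(2) \<delta>2(2) uniform_limit_on_subset[OF \<delta>1(2)] by (auto simp: \<rho>_def subset_ball)
  have small: "ball x \<rho> \<subseteq> ball z (2 * \<rho>)" if "x \<in> ball z \<rho>" for x
    using that by (simp add: subset_ball ball_subset_ball_iff dist_commute)
  have sub: "ball z \<rho> \<subseteq> U" using big(1) \<rho> by auto
  have "\<exists>f'. Vector_Spaces.linear (*s) (*s) f' \<and> (f n has_derivative f') (at x)"
    if "x \<in> ball z \<rho>" for n x
  proof -
    have "x \<in> U" using sub that by blast
    then show ?thesis
      using hol[of n] at_within_open[OF _ \<open>open U\<close>] by (auto simp: holomorphic_map_on_def)
  qed
  \<comment> \<open>Pairs \<open>(n, x)\<close> let a single application of choice select all
    derivatives.\<close>
  then have ex: "\<forall>p. \<exists>f'. snd p \<in> ball z \<rho> \<longrightarrow>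
      Vector_Spaces.linear (*s) (*s) f' \<and> (f (fst p) has_derivative f') (at (snd p))"
    by blast
  obtain f'' where f'': "\<forall>p. snd p \<in> ball z \<rho> \<longrightarrow>
      Vector_Spaces.linear (*s) (*s) (f'' p) \<and> (f (fst p) has_derivative f'' p) (at (snd p))"
    using choice[OF ex] by blast
  define f' where "f' n x = f'' (n, x)" for n x
  have f': "Vector_Spaces.linear (*s) (*s) (f' n x)" "(f n has_derivative f' n x) (at x)"
    if "x \<in> ball z \<rho>" for n x
    using f''[rule_format, of "(n, x)"] that by (simp_all add: f'_def)
  define K where "K = real CARD('m) * (2 / \<rho>)"
  have K: "K > 0" using \<rho> by (simp add: K_def)
  have est: "norm (f' n x h - f' m x h) \<le> K * B * norm h"
    if "x \<in> ball z \<rho>" "\<And>w. w \<in> ball z (2 * \<rho>) \<Longrightarrow> norm (f n w - f m w) \<le> B" for n m x h B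
  proof -
    have "norm (f' n x h - f' m x h) \<le> real CARD('m) * (2 * B / \<rho>) * norm h"
    proof (rule cauchy_estimate_derivative)
      show "holomorphic_map_on (\<lambda>w. f n w - f m w) (ball x \<rho>)"
        using small[OF that(1)] big(1)
        by (intro holomorphic_map_on_diff holomorphic_map_on_subset[OF hol]) blast+
      show "((\<lambda>w. f n w - f m w) has_derivative (\<lambda>h. f' n x h - f' m x h)) (at x)"
        using f'(2) that(1) by (intro has_derivative_diff) auto
      show "norm (f n w - f m w) \<le> B" if "w \<in> ball x \<rho>" for w
        using that small \<open>x \<in> ball z \<rho>\<close> \<open>\<And>w. w \<in> ball z (2 * \<rho>) \<Longrightarrow> norm (f n w - f m w) \<le> B\<close> by blast
    qed (rule \<rho>)
    then show ?thesis by (simp add: K_def field_simps)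
  qed
  have cau: "\<exists>N. \<forall>m\<ge>N. \<forall>n\<ge>N. \<forall>w\<in>ball z (2 * \<rho>). norm (f n w - f m w) \<le> e" if "e > 0" for e
  proof -
    have "uniformly_Cauchy_on (ball z (2 * \<rho>)) f"
      using big(2) uniformly_convergent_Cauchy uniformly_convergent_on_def by blast
    then show ?thesis
      using that unfolding uniformly_Cauchy_on_def by (metis dist_norm less_imp_le)
  qed
  have conv: "(\<lambda>n. f' n x h) \<longlonglongrightarrow> lim (\<lambda>n. f' n x h)" if "x \<in> ball z \<rho>" for x h
  proof -
    have "Cauchy (\<lambda>n. f' n x h)"
    proof (rule metric_CauchyI)
      fix e :: real assume e: "e > 0"
      \<comment> \<open>\<open>norm h + 1\<close> instead of \<open>norm h\<close> also covers
        \<open>h = 0\<close>.\<close>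
      have "e / (2 * K * (norm h + 1)) > 0" using e K by (simp add: add_nonneg_pos)
      from cau[OF this] obtain N where N: "\<And>m n w. m \<ge> N \<Longrightarrow> n \<ge> N \<Longrightarrow> w \<in> ball z (2 * \<rho>) \<Longrightarrow>
          norm (f n w - f m w) \<le> e / (2 * K * (norm h + 1))" by blast
      have "dist (f' n x h) (f' m x h) < e" if "m \<ge> N" "n \<ge> N" for m n
      proof -
        have "norm (f' n x h - f' m x h) \<le> K * (e / (2 * K * (norm h + 1))) * norm h"
          using est[OF \<open>x \<in> ball z \<rho>\<close> N] that by blast
        also have "\<dots> = (e / 2) * (norm h / (norm h + 1))" using K by simp
        also have "\<dots> \<le> (e / 2) * 1"
          using e by (intro mult_left_mono) (auto simp: divide_simps add_nonneg_pos not_less add_nonneg_nonneg)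
        finally show ?thesis using e by (simp add: dist_norm)
      qed
      then show "\<exists>N. \<forall>m\<ge>N. \<forall>n\<ge>N. dist (f' m x h) (f' n x h) < e" by blast
    qed
    then show ?thesis by (simp add: Cauchy_convergent_iff convergent_LIMSEQ_iff)
  qed
  define g' where "g' x h = lim (\<lambda>n. f' n x h)" for x h
  have "\<exists>G. \<forall>x\<in>ball z \<rho>. (\<lambda>n. f n x) \<longlonglongrightarrow> G x \<and> (G has_derivative g' x) (at x within ball z \<rho>)"
  proof (rule has_derivative_sequence)
    show "(f n has_derivative f' n x) (at x within ball z \<rho>)" if "x \<in> ball z \<rho>" for n x
      using f'(2) that has_derivative_at_withinI by blast
    show "\<forall>\<^sub>F n in sequentially. \<forall>x\<in>ball z \<rho>. \<forall>h. norm (f' n x h - g' x h) \<le> e * norm h"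
      if "e > 0" for e
    proof -
      have "e / K > 0" using that K by simp
      from cau[OF this] obtain N where N: "\<And>m n w. m \<ge> N \<Longrightarrow> n \<ge> N \<Longrightarrow> w \<in> ball z (2 * \<rho>) \<Longrightarrow>
          norm (f n w - f m w) \<le> e / K" by blast
      have "norm (f' n x h - g' x h) \<le> e * norm h" if n: "n \<ge> N" and x: "x \<in> ball z \<rho>" for n x h
      proof (rule Lim_bounded)
        show "(\<lambda>m. norm (f' n x h - f' m x h)) \<longlonglongrightarrow> norm (f' n x h - g' x h)"
          unfolding g'_def by (intro tendsto_intros conv x)
        show "\<forall>m\<ge>N. norm (f' n x h - f' m x h) \<le> e * norm h"
          using est[OF x N] n K by fastforce
      qed
      then show ?thesis unfolding eventually_sequentially by blast
    qed
    show "(\<lambda>n. f n z) \<longlonglongrightarrow> g z"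
      using big(2) \<rho> by (intro tendsto_uniform_limitI[where S = "ball z (2 * \<rho>)"]) auto
  qed (use \<rho> in auto)
  then obtain G where G: "\<And>x. x \<in> ball z \<rho> \<Longrightarrow> (\<lambda>n. f n x) \<longlonglongrightarrow> G x"
      "\<And>x. x \<in> ball z \<rho> \<Longrightarrow> (G has_derivative g' x) (at x within ball z \<rho>)" by blast
  \<comment> \<open>The theorem on sequences of derivatives provides a limit \<open>G\<close> of its
    own, which is identified with \<open>g\<close> here.\<close>
  have "G x = g x" if "x \<in> ball z \<rho>" for x
  proof (rule LIMSEQ_unique[OF G(1)[OF that]])
    show "(\<lambda>n. f n x) \<longlonglongrightarrow> g x"
      using big(2) \<rho> that by (intro tendsto_uniform_limitI[where S = "ball z (2 * \<rho>)"]) auto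
  qed
  then have "(g has_derivative g' z) (at z within ball z \<rho>)"
    using G(2)[of z] \<rho> by (intro has_derivative_transform[OF _ _ G(2)]) auto
  then have "(g has_derivative g' z) (at z)"
    using \<rho> by (simp add: at_within_open[of z "ball z \<rho>"])
  then have "(g has_derivative g' z) (at z within U)"
    by (rule has_derivative_at_withinI)
  moreover have "Vector_Spaces.linear (*s) (*s) (g' z)"
    unfolding linear_smult_iff
  proof (intro conjI allI)
    have zz: "z \<in> ball z \<rho>" using \<rho> by simp
    note lin = f'(1)[OF zz, unfolded linear_smult_iff]
    fix x y :: "complex ^ 'k" and c
    have "(\<lambda>n. f' n z (x + y)) \<longlonglongrightarrow> g' z x + g' z y"
      using tendsto_add[OF conv[OF zz, of x] conv[OF zz, of y]] lin by (simp add: g'_def)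
    then show "g' z (x + y) = g' z x + g' z y"
      using conv[OF zz, of "x + y"] LIMSEQ_unique by (auto simp: g'_def)
    have "(\<lambda>n. f' n z (c *s x)) \<longlonglongrightarrow> c *s g' z x"
      using bounded_bilinear.tendsto[OF bounded_bilinear_vector_smult tendsto_const conv[OF zz, of x]] lin
      by (simp add: g'_def)
    then show "g' z (c *s x) = c *s g' z x"
      using conv[OF zz, of "c *s x"] LIMSEQ_unique by (auto simp: g'_def)
  qed
  ultimately show "\<exists>f'. Vector_Spaces.linear (*s) (*s) f' \<and> (g has_derivative f') (at z within U)"
    by blast
qed

section \<open>Hausdorff dimension of sets of positive measure\<close>

text \<open>A set of diameter \<open>d\<close> lies in a closed ball of radius \<open>d\<close>
  about any of its points, and \<open>d ^ DIM('a)\<close> is at most \<open>d powr s\<close> because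
  \<open>d \<le> 1\<close> and \<open>s \<le> DIM('a)\<close>.\<close>

lemma emeasure_le_hausdorff_sum:
  fixes A :: "'a::euclidean_space set"
  assumes "A \<in> sets lborel" and s: "0 \<le> s" "s \<le> real DIM('a)"
    and U: "A \<subseteq> (\<Union>i. U i)" "\<And>i. bounded (U i)" "\<And>i. diameter (U i) \<le> 1"
  shows "emeasure lborel A \<le> ennreal (unit_ball_vol DIM('a)) * (\<Sum>i::nat. diam_power s (U i))"
proof -
  \<comment> \<open>Empty covering sets offer no centre for a ball; they keep volume 0, matching
    their weight.\<close>
  define V where "V i = (if U i = {} then {} else cball (SOME x. x \<in> U i) (diameter (U i)))" for i
  have sub: "U i \<subseteq> V i" for i
  proof (cases "U i = {}")
    case False
    then have "(SOME x. x \<in> U i) \<in> U i" by (simp add: some_in_eq)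
    then show ?thesis
      using diameter_bounded_bound[OF U(2)] False by (auto simp: V_def)
  qed simp
  have le: "emeasure lborel (V i) \<le> ennreal (unit_ball_vol DIM('a)) * diam_power s (U i)" for i
  proof (cases "U i = {}")
    case False
    let ?r = "diameter (U i)"
    have r: "0 \<le> ?r" "?r \<le> 1" using U by (auto simp: diameter_ge_0)
    have "ennreal (?r ^ DIM('a)) \<le> diam_power s (U i)"
    \<comment> \<open>These cases are separate because \<open>diam_power\<close> has weight 1 for
      \<open>s = 0\<close>, and \<open>powr\<close> vanishes at base 0.\<close>
    proof (cases "s = 0 \<or> ?r = 0")
      case True
      then show ?thesis using r False
        by (auto simp: diam_power_def power_le_one ennreal_le_1 zero_power)
    next
      case r0: False
      then have "?r ^ DIM('a) \<le> ?r powr s"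
        using r s by (simp add: powr_realpow [symmetric] powr_mono')
      then show ?thesis using False r0 by (simp add: diam_power_def ennreal_leI)
    qed
    then show ?thesis
      using False r by (simp add: V_def emeasure_cball ennreal_mult'' mult_left_mono)
  qed (simp add: V_def)
  have V: "V i \<in> sets lborel" for i by (simp add: V_def)
  have "emeasure lborel A \<le> emeasure lborel (\<Union>i. V i)"
    using U(1) sub V by (intro emeasure_mono) (blast, auto)
  also have "\<dots> \<le> (\<Sum>i. emeasure lborel (V i))"
    using V by (intro emeasure_subadditive_countably) auto
  also have "\<dots> \<le> (\<Sum>i. ennreal (unit_ball_vol DIM('a)) * diam_power s (U i))"
    by (intro suminf_le le) auto
  finally show ?thesis by simp
qed

text \<open>Comparison with volume: a vanishing measure would give, already at scale 1, covers of
  arbitrarily small total weight, and these bound the volume of \<open>A\<close> up to a constant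
  factor.\<close>

lemma hausdorff_measure_neq_0:
  fixes A :: "'a::euclidean_space set"
  assumes "A \<in> sets lborel" and s: "0 \<le> s" "s \<le> real DIM('a)" and "emeasure lborel A \<noteq> 0"
  shows "hausdorff_measure s A \<noteq> 0"
proof
  assume "hausdorff_measure s A = 0"
  moreover have "hausdorff_premeasure s 1 A \<le> hausdorff_measure s A"
    unfolding hausdorff_measure_def by (rule SUP_upper) simp
  ultimately have 0: "hausdorff_premeasure s 1 A = 0" by simp
  define c where "c = unit_ball_vol DIM('a)"
  have c: "c > 0" by (simp add: c_def)
  obtain e where e: "e > 0" "ennreal e < emeasure lborel A"
    using assms(4) by (metis ennreal_less_zero_iff dense ennreal_cases ennreal_neq_top
        less_top_ennreal not_gr_zero order_less_trans top_greatest)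
  have "hausdorff_premeasure s 1 A < ennreal (e / c)"
    using 0 c e by simp
  then obtain U where U: "A \<subseteq> (\<Union>i. U i)" "\<And>i. bounded (U i)" "\<And>i. diameter (U i) \<le> 1"
      "(\<Sum>i::nat. diam_power s (U i)) < ennreal (e / c)"
    unfolding hausdorff_premeasure_def INF_less_iff by auto
  have "emeasure lborel A \<le> ennreal c * (\<Sum>i. diam_power s (U i))"
    unfolding c_def by (rule emeasure_le_hausdorff_sum) (use assms U in auto)
  also have "\<dots> \<le> ennreal c * ennreal (e / c)"
    using U(4) by (intro mult_left_mono) auto
  also have "\<dots> = ennreal e"
    using c e by (simp add: ennreal_mult' [symmetric])
  finally show False using e by simp
qed

text \<open>The cube of side \<open>2 * R\<close> around the origin is cut into
  \<open>N ^ DIM('a)\<close> congruent cells. The diameter of a cell is estimated by the sum of its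
  side lengths, hence the factor \<open>DIM('a)\<close>.\<close>

lemma hausdorff_premeasure_le_grid:
  fixes A :: "'a::euclidean_space set"
  assumes A: "A \<subseteq> cball 0 R" and "0 < R" and N: "0 < N" and s: "0 < s"
    and \<delta>: "real DIM('a) * (2 * R / N) \<le> \<delta>"
  shows "hausdorff_premeasure s \<delta> A \<le>
    ennreal (real (N ^ DIM('a)) * (real DIM('a) * (2 * R / N)) powr s)"
proof -
  define d where "d = real DIM('a) * (2 * R / N)"
  define P where "P = (Basis :: 'a set) \<rightarrow>\<^sub>E {..<N}"
  define cell where "cell f = {x :: 'a. \<forall>b\<in>Basis.
      - R + 2 * R * real (f b) / N \<le> x \<bullet> b \<and> x \<bullet> b \<le> - R + 2 * R * (real (f b) + 1) / N}" for f
  have fin: "finite P" and card: "card P = N ^ DIM('a)"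
    by (auto simp: P_def card_PiE intro!: finite_PiE)
  have dist_cell: "norm (x - y) \<le> d" if "x \<in> cell f" "y \<in> cell f" for f x y
  proof -
    have "\<bar>(x - y) \<bullet> b\<bar> \<le> 2 * R / N" if "b \<in> Basis" for b
    proof -
      have "- R + 2 * R * real (f b) / N \<le> x \<bullet> b" "x \<bullet> b \<le> - R + 2 * R * (real (f b) + 1) / N"
        "- R + 2 * R * real (f b) / N \<le> y \<bullet> b" "y \<bullet> b \<le> - R + 2 * R * (real (f b) + 1) / N"
        using that \<open>x \<in> cell f\<close> \<open>y \<in> cell f\<close> by (auto simp: cell_def)
      moreover have "2 * R * (real (f b) + 1) / N = 2 * R * real (f b) / N + 2 * R / N"
        by (simp add: field_simps add_divide_distrib)
      ultimately show ?thesis by (simp add: inner_diff_left)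
    qed
    then have "(\<Sum>b\<in>(Basis::'a set). \<bar>(x - y) \<bullet> b\<bar>) \<le> real DIM('a) * (2 * R / N)"
      by (intro sum_bounded_above) auto
    then show ?thesis
      using norm_le_l1[of "x - y"] by (simp add: d_def)
  qed
  have bdd: "bounded (cell f)" for f
    unfolding bounded_two_points using dist_cell by (metis dist_norm)
  have d0: "0 \<le> d" using assms by (simp add: d_def)
  have diam: "diameter (cell f) \<le> d" for f
    by (rule diameter_le) (use dist_cell d0 in auto)
  have cover: "\<exists>f\<in>P. x \<in> cell f" if "x \<in> A" for x
  proof -
    define t where "t b = (x \<bullet> b + R) * N / (2 * R)" for b
    \<comment> \<open>The cap \<open>N - 1\<close> assigns the far face, where
      \<open>t b = N\<close>, to the last cell.\<close>
    define f where "f = (\<lambda>b\<in>Basis. min (nat \<lfloor>t b\<rfloor>) (N - 1))"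
    have "f \<in> P" using N by (auto simp: f_def P_def)
    moreover have "- R + 2 * R * real (f b) / N \<le> x \<bullet> b \<and>
        x \<bullet> b \<le> - R + 2 * R * (real (f b) + 1) / N" if b: "b \<in> Basis" for b
    proof -
      have "\<bar>x \<bullet> b\<bar> \<le> R"
        using Basis_le_norm[OF b, of x] A \<open>x \<in> A\<close> by (force simp: dist_norm)
      then have "0 \<le> (x \<bullet> b + R) * N" "(x \<bullet> b + R) * N \<le> (2 * R) * N"
        using N by (auto intro!: mult_right_mono)
      then have t: "0 \<le> t b" "t b \<le> N" using \<open>0 < R\<close> by (simp_all add: t_def divide_simps mult.commute)
      have x: "x \<bullet> b = - R + 2 * R * t b / N"
        using N \<open>0 < R\<close> by (simp add: t_def)
      have "real (f b) \<le> t b" "t b \<le> real (f b) + 1"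
      proof -
        have fb: "f b = min (nat \<lfloor>t b\<rfloor>) (N - 1)" using b by (simp add: f_def)
        have fl: "real (nat \<lfloor>t b\<rfloor>) \<le> t b" "t b \<le> real (nat \<lfloor>t b\<rfloor>) + 1"
          using t by linarith+
        show "real (f b) \<le> t b" using fl fb by linarith
        show "t b \<le> real (f b) + 1" using fl fb t N by (auto simp: min_def of_nat_diff)
      qed
      then have "2 * R * real (f b) / N \<le> 2 * R * t b / N" "2 * R * t b / N \<le> 2 * R * (real (f b) + 1) / N"
        using \<open>0 < R\<close> N by (auto intro!: divide_right_mono mult_left_mono)
      then show ?thesis using x by linarith
    qed
    ultimately show ?thesis by (auto simp: cell_def)
  qed
  obtain h where h: "bij_betw h {0..<card P} P"
    using ex_bij_betw_nat_finite[OF fin] by blast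
  \<comment> \<open>The finite cover is continued by empty sets, which have weight 0.\<close>
  define U where "U i = (if i < card P then cell (h i) else {})" for i
  have "A \<subseteq> (\<Union>i. U i)"
  proof
    fix x assume "x \<in> A"
    then obtain f where f: "f \<in> P" "x \<in> cell f" using cover by blast
    then obtain i where "i < card P" "h i = f"
      using h by (metis atLeastLessThan_iff bij_betw_iff_bijections)
    then show "x \<in> (\<Union>i. U i)" using f by (auto simp: U_def)
  qed
  then have "hausdorff_premeasure s \<delta> A \<le> (\<Sum>i. diam_power s (U i))"
    unfolding hausdorff_premeasure_def
    by (intro INF_lower) (use bdd diam \<delta> d0 in \<open>auto simp: U_def d_def intro: order_trans\<close>)
  also have "\<dots> = (\<Sum>i<card P. diam_power s (U i))"
    by (rule suminf_finite) (auto simp: U_def diam_power_def)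
  also have "\<dots> \<le> (\<Sum>i<card P. ennreal (d powr s))"
    using s diam diameter_ge_0[OF bdd]
    by (intro sum_mono) (auto simp: U_def diam_power_def intro!: ennreal_leI powr_mono2)
  also have "\<dots> = ennreal (real (N ^ DIM('a)) * d powr s)"
    by (simp add: card ennreal_mult' ennreal_of_nat_eq_real_of_nat)
  finally show ?thesis by (simp add: d_def)
qed

text \<open>The grid with \<open>N\<close> cells per side has total weight a constant times
  \<open>N powr (DIM('a) - s)\<close>, which tends to 0.\<close>

lemma hausdorff_measure_eq_0:
  fixes A :: "'a::euclidean_space set"
  assumes "bounded A" and s: "real DIM('a) < s"
  shows "hausdorff_measure s A = 0"
proof -
  obtain R where R: "0 < R" "A \<subseteq> cball 0 R"
    using \<open>bounded A\<close> unfolding bounded_pos by (metis mem_cball_0 subsetI)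
  define C where "C = real DIM('a) * (2 * R)"
  have C: "C > 0" using R by (simp add: C_def)
  have "hausdorff_premeasure s \<delta> A = 0" if "\<delta> > 0" for \<delta>
  proof -
    have lim: "(\<lambda>N. ennreal (C powr s * real N powr (real DIM('a) - s))) \<longlonglongrightarrow> ennreal (C powr s * 0)"
      using s by (intro tendsto_ennrealI tendsto_mult tendsto_const tendsto_neg_powr
          filterlim_real_sequentially) auto
    have "(\<lambda>N. C / real N) \<longlonglongrightarrow> 0"
      by (rule lim_const_over_n)
    then have "\<forall>\<^sub>F N in sequentially. C / real N < \<delta>"
      using that by (rule order_tendstoD)
    then have "\<forall>\<^sub>F N in sequentially. hausdorff_premeasure s \<delta> A \<le>
        ennreal (C powr s * real N powr (real DIM('a) - s))"
      using eventually_gt_at_top[of 0]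
    proof eventually_elim
      case (elim N)
      have "hausdorff_premeasure s \<delta> A \<le>
          ennreal (real (N ^ DIM('a)) * (real DIM('a) * (2 * R / N)) powr s)"
        using elim R s by (intro hausdorff_premeasure_le_grid) (auto simp: C_def)
      also have "real (N ^ DIM('a)) * (real DIM('a) * (2 * R / N)) powr s =
          real N powr real DIM('a) * (C / N) powr s"
        using elim by (simp add: C_def powr_realpow)
      also have "\<dots> = C powr s * real N powr (real DIM('a) - s)"
        using elim C by (simp add: powr_divide powr_diff)
      finally show ?case .
    qed
    then have "hausdorff_premeasure s \<delta> A \<le> ennreal (C powr s * 0)"
      by (intro tendsto_lowerbound[OF lim]) auto
    then show ?thesis by simp
  qed
  then show ?thesis by (simp add: hausdorff_measure_def)
qed

lemma hausdorff_dim_eq_DIM: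
  fixes A :: "'a::euclidean_space set"
  assumes "A \<in> sets lborel" "bounded A" "emeasure lborel A \<noteq> 0"
  shows "hausdorff_dim A = ereal (real DIM('a))"
proof (rule antisym)
  show "hausdorff_dim A \<le> ereal (real DIM('a))"
  \<comment> \<open>At the exponent \<open>DIM('a)\<close> itself the measure is positive, so the
    bound is approached from above.\<close>
  proof (rule ereal_le_epsilon2)
    fix e :: real assume "0 < e"
    then have "hausdorff_measure (real DIM('a) + e) A = 0"
      using assms(2) by (intro hausdorff_measure_eq_0) auto
    then show "hausdorff_dim A \<le> ereal (real DIM('a)) + ereal e"
      unfolding hausdorff_dim_def using \<open>0 < e\<close> by (intro INF_lower2[of "real DIM('a) + e"]) auto
  qed
  show "ereal (real DIM('a)) \<le> hausdorff_dim A"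
    unfolding hausdorff_dim_def
    using hausdorff_measure_neq_0[OF assms(1) _ _ assms(3)] by (intro INF_greatest) (force simp: not_le)
qed

section \<open>Shears close to the identity on a polydisc\<close>

definition polydisc :: "real \<Rightarrow> (complex ^ 'k) set" where
  "polydisc s = {z. \<forall>i. norm (z $ i) \<le> s}"

lemma polydiscD: "z \<in> polydisc s \<Longrightarrow> norm (z $ i) \<le> s"
  by (simp add: polydisc_def)

lemma polydisc_mono: "s \<le> t \<Longrightarrow> polydisc s \<subseteq> polydisc t"
  by (auto simp: polydisc_def intro: order_trans)

lemma polydisc_add: "z \<in> polydisc s \<Longrightarrow> norm (w - z) \<le> e \<Longrightarrow> s + e \<le> t \<Longrightarrow> w \<in> polydisc t"
  unfolding polydisc_def
proof (safe)
  fix i assume *: "\<forall>i. norm (z $ i) \<le> s" "norm (w - z) \<le> e" "s + e \<le> t"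
  have "norm (w $ i - z $ i) \<le> norm (w - z)"
    by (metis Finite_Cartesian_Product.norm_nth_le vector_minus_component)
  then show "norm (w $ i) \<le> t"
    using *(1)[rule_format, of i] *(2,3) norm_triangle_sub[of "w $ i" "z $ i"] by linarith
qed

lemma norm_le_polydisc: "z \<in> polydisc s \<Longrightarrow> norm z \<le> real CARD('k) * s" for z :: "complex ^ 'k"
  using order_trans[OF norm_le_sum_norm_nth[of z] sum_bounded_above[of UNIV "\<lambda>i. norm (z $ i)" s]]
  by (auto simp: polydisc_def)

lemma compact_polydisc: "compact (polydisc s :: (complex ^ 'k) set)"
proof -
  have "polydisc s = (\<Inter>i. {z :: complex ^ 'k. norm (z $ i) \<le> s})"
    by (auto simp: polydisc_def)
  moreover have "closed {z :: complex ^ 'k. norm (z $ i) \<le> s}" for i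
    by (intro closed_Collect_le continuous_intros)
  ultimately have "closed (polydisc s :: (complex ^ 'k) set)" by auto
  moreover have "bounded (polydisc s :: (complex ^ 'k) set)"
    unfolding bounded_iff using norm_le_polydisc by blast
  ultimately show ?thesis by (simp add: compact_eq_bounded_closed)
qed

lemma compact_subset_polydisc:
  fixes D :: "(complex ^ 'k) set"
  assumes "compact D"
  obtains R where "0 < R" "D \<subseteq> polydisc R"
proof -
  obtain R where "0 < R" "\<forall>z\<in>D. norm z \<le> R"
    using compact_imp_bounded[OF assms] unfolding bounded_pos by blast
  then have "D \<subseteq> polydisc R"
    unfolding polydisc_def using Finite_Cartesian_Product.norm_nth_le order_trans by blast
  then show ?thesis using \<open>0 < R\<close> that by blast
qed

text \<open>Scaling by \<open>1 / (1 + \<gamma>)\<close> maps the larger polydisc into the unit one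
  and moves each of its points by at most \<open>d / 2\<close>, where \<open>d\<close> is a positive
  lower bound for the distance of \<open>D\<close> from \<open>polydisc 1\<close>.\<close>

lemma compact_disjoint_polydisc:
  fixes D :: "(complex ^ 'k) set"
  assumes "compact D" "D \<inter> polydisc 1 = {}"
  obtains \<rho> where "1 < \<rho>" "D \<inter> polydisc \<rho> = {}"
proof -
  obtain d where d: "d > 0" "\<forall>x\<in>D. \<forall>y\<in>polydisc 1. d \<le> dist x y"
    using separate_compact_closed[OF assms(1) compact_imp_closed[OF compact_polydisc] assms(2)] by blast
  define \<gamma> where "\<gamma> = d / (2 * real CARD('k))"
  have \<gamma>: "\<gamma> > 0" using d by (simp add: \<gamma>_def)
  have "z \<notin> polydisc (1 + \<gamma>)" if "z \<in> D" for z
  proof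
    assume z: "z \<in> polydisc (1 + \<gamma>)"
    define w where "w = (1 / (1 + \<gamma>)) *\<^sub>R z"
    have "norm (z $ i) / (1 + \<gamma>) \<le> 1" for i
      using polydiscD[OF z] \<gamma> by simp
    then have w: "w \<in> polydisc 1" using \<gamma> by (simp add: w_def polydisc_def)
    have "z - w = (\<gamma> / (1 + \<gamma>)) *\<^sub>R z"
      unfolding w_def using \<gamma>
      by (subst scaleR_one[of z, symmetric], subst scaleR_left_diff_distrib[symmetric])
         (simp add: field_simps)
    then have "dist z w = \<gamma> / (1 + \<gamma>) * norm z" using \<gamma> by (simp add: dist_norm)
    also have "\<dots> \<le> \<gamma> / (1 + \<gamma>) * (real CARD('k) * (1 + \<gamma>))"
      using norm_le_polydisc[OF z] \<gamma> by (intro mult_left_mono) auto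
    also have "\<dots> = \<gamma> * real CARD('k)" using \<gamma> by simp
    also have "\<dots> = d / 2" by (simp add: \<gamma>_def)
    finally show False using d w that by fastforce
  qed
  then show ?thesis using that[of "1 + \<gamma>"] \<gamma> by auto
qed

text \<open>The inverse is controlled as well, because the construction takes limits both of the
  automorphisms and of their inverses.\<close>

definition near_id :: "real \<Rightarrow> real \<Rightarrow> (complex ^ 'k \<Rightarrow> complex ^ 'k) \<Rightarrow> bool" where
  "near_id s e f \<longleftrightarrow> (\<forall>z\<in>polydisc s. norm (f z - z) \<le> e \<and> norm (inv f z - z) \<le> e)"

text \<open>Displacements add up as long as the map applied first keeps points inside
  \<open>polydisc s\<close>. For the inverse the order of the factors is reversed, hence the two
  margin conditions on \<open>s'\<close>.\<close>

lemma near_id_compose: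
  assumes f: "automorphism f" "near_id s e f" and g: "automorphism g" "near_id s e' g"
    and "s' + e \<le> s" "s' + e' \<le> s" "0 \<le> e" "0 \<le> e'"
  shows "near_id s' (e + e') (g \<circ> f)"
  unfolding near_id_def
proof
  fix z :: "complex ^ 'a" assume z: "z \<in> polydisc s'"
  then have z': "z \<in> polydisc s" using polydisc_mono[of s' s] assms by auto
  have step: "norm (q (p z) - z) \<le> a + b"
    if "norm (p z - z) \<le> a" "s' + a \<le> s" "\<And>w. w \<in> polydisc s \<Longrightarrow> norm (q w - w) \<le> b" for p q a b
  proof -
    have "norm (q (p z) - p z) \<le> b" using polydisc_add[OF z that(1,2)] that(3) by blast
    then show ?thesis using that(1) norm_triangle_ineq[of "q (p z) - p z" "p z - z"] by simp
  qed
  have "norm (g (f z) - z) \<le> e + e'" "norm (inv f (inv g z) - z) \<le> e' + e"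
    using assms z' unfolding near_id_def by (auto intro: step)
  then show "norm ((g \<circ> f) z - z) \<le> e + e' \<and> norm (inv (g \<circ> f) z - z) \<le> e + e'"
    by (simp add: inv_automorphism_compose f g)
qed

lemma near_id_subset: "near_id s e f \<Longrightarrow> s' \<le> s \<Longrightarrow> e \<le> e' \<Longrightarrow> near_id s' e' f"
  unfolding near_id_def using polydisc_mono[of s' s] by fastforce

text \<open>The inverse is the shear along \<open>- v\<close>, so one estimate serves both
  directions.\<close>

lemma near_id_power_shear:
  fixes v :: "complex ^ 'k"
  assumes "\<And>j. j \<in> J \<Longrightarrow> v $ j = 0"
    and "\<And>z :: complex ^ 'k. z \<in> polydisc s \<Longrightarrow> norm (\<Sum>j\<in>J. c j * (z $ j) ^ N j) * norm v \<le> e"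
  shows "near_id s e (power_shear J c N v)"
proof -
  have "inv (power_shear J c N v) = power_shear J c N (- v)"
    by (rule inv_power_shear) (rule assms(1))
  then show ?thesis
    unfolding near_id_def using assms(2) by (simp add: power_shear_def norm_vector_smult)
qed

section \<open>High powers as approximate cut-off functions\<close>

lemma power_gap:
  fixes s \<rho> t \<epsilon> M :: real
  assumes "0 \<le> s" "s < \<rho>" "\<rho> < t" "0 < \<epsilon>"
  obtains n where "(s / \<rho>) ^ n \<le> \<epsilon>" "M \<le> (t / \<rho>) ^ n"
proof -
  obtain n1 where n1: "(s / \<rho>) ^ n1 < \<epsilon>"
    using real_arch_pow_inv[of \<epsilon> "s / \<rho>"] assms by auto
  obtain n2 where n2: "M < (t / \<rho>) ^ n2"
    using real_arch_pow[of "t / \<rho>" M] assms by auto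
  have "(s / \<rho>) ^ (n1 + n2) \<le> (s / \<rho>) ^ n1" "(t / \<rho>) ^ n2 \<le> (t / \<rho>) ^ (n1 + n2)"
    using assms by (intro power_decreasing power_increasing; simp)+
  then show ?thesis using that[of "n1 + n2"] n1 n2 by linarith
qed

text \<open>
  The exponents grow from one index to the next so quickly that no cancellation occurs
  between the summands.
\<close>

lemma power_sum_gap:
  fixes J :: "'k::finite set"
  assumes "0 \<le> s" "s < t"
  shows "0 < \<epsilon> \<Longrightarrow> \<exists>c N. \<forall>z :: complex ^ 'k. z \<in> polydisc R \<longrightarrow>
    ((\<forall>j\<in>J. norm (z $ j) \<le> s) \<longrightarrow> norm (\<Sum>j\<in>J. c j * (z $ j) ^ N j) \<le> \<epsilon>) \<and>
    ((\<forall>j\<in>J. norm (z $ j) \<le> s \<or> t \<le> norm (z $ j)) \<and> (\<exists>j\<in>J. t \<le> norm (z $ j)) \<longrightarrow>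
      M \<le> norm (\<Sum>j\<in>J. c j * (z $ j) ^ N j))"
  using finite[of J]
proof (induction J arbitrary: \<epsilon> M rule: finite_induct)
  case empty
  then show ?case by auto
next
  case (insert i J)
  have "0 < \<epsilon> / 2" using insert.prems by simp
  \<comment> \<open>\<open>M + 1\<close> compensates for the new term, which is at most 1 when
    coordinate \<open>i\<close> is small.\<close>
  from insert.IH[OF this, of "M + 1"] obtain c N where IH: "\<And>z :: complex ^ 'k. z \<in> polydisc R \<Longrightarrow>
      ((\<forall>j\<in>J. norm (z $ j) \<le> s) \<longrightarrow> norm (\<Sum>j\<in>J. c j * (z $ j) ^ N j) \<le> \<epsilon> / 2) \<and>
      ((\<forall>j\<in>J. norm (z $ j) \<le> s \<or> t \<le> norm (z $ j)) \<and> (\<exists>j\<in>J. t \<le> norm (z $ j)) \<longrightarrow>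
        M + 1 \<le> norm (\<Sum>j\<in>J. c j * (z $ j) ^ N j))" by blast
  define h where "h z = (\<Sum>j\<in>J. c j * (z $ j) ^ N j)" for z :: "complex ^ 'k"
  define B where "B = (\<Sum>j\<in>J. norm (c j) * R ^ N j)"
  have B: "norm (h z) \<le> B" if "z \<in> polydisc R" for z
    unfolding h_def B_def
  proof (rule order_trans[OF norm_sum sum_mono])
    fix j show "norm (c j * (z $ j) ^ N j) \<le> norm (c j) * R ^ N j"
      using that by (auto simp: norm_mult norm_power polydisc_def intro!: mult_left_mono power_mono)
  qed
  define \<rho> where "\<rho> = (s + t) / 2"
  have \<rho>: "s < \<rho>" "\<rho> < t" "0 < \<rho>" using assms by (auto simp: \<rho>_def)
  \<comment> \<open>\<open>B\<close> bounds the earlier terms on the whole polydisc, so with this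
    exponent the new term exceeds them by \<open>M\<close> once the modulus of coordinate
    \<open>i\<close> reaches \<open>t\<close>.\<close>
  obtain n where n: "(s / \<rho>) ^ n \<le> min (\<epsilon> / 2) 1" "M + B \<le> (t / \<rho>) ^ n"
    using power_gap[OF assms(1) \<rho>(1,2), of "min (\<epsilon> / 2) 1"] insert.prems by auto
  define c' where "c' = c(i := 1 / of_real \<rho> ^ n)"
  define N' where "N' = N(i := n)"
  have sum: "(\<Sum>j\<in>insert i J. c' j * (z $ j) ^ N' j) = (z $ i / of_real \<rho>) ^ n + h z" for z
    using insert.hyps unfolding h_def
    by (simp add: c'_def N'_def power_divide) (rule sum.cong, auto)
  have ni: "norm ((z $ i / of_real \<rho>) ^ n) = (norm (z $ i) / \<rho>) ^ n" for z :: "complex ^ 'k"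
    using \<rho> by (simp add: norm_power norm_divide)
  show ?case
  proof (rule exI[of _ c'], rule exI[of _ N'], unfold sum, intro allI impI conjI)
    fix z :: "complex ^ 'k"
    assume z: "z \<in> polydisc R"
    have lo: "norm ((z $ i / of_real \<rho>) ^ n) \<le> min (\<epsilon> / 2) 1" if "norm (z $ i) \<le> s"
      unfolding ni using that \<rho> by (intro order_trans[OF power_mono n(1)] divide_right_mono) auto
    {
      assume "\<forall>j\<in>insert i J. norm (z $ j) \<le> s"
      then have "norm ((z $ i / of_real \<rho>) ^ n) \<le> \<epsilon> / 2" "norm (h z) \<le> \<epsilon> / 2"
        using lo IH[OF z] by (auto simp: h_def)
      then show "norm ((z $ i / of_real \<rho>) ^ n + h z) \<le> \<epsilon>"
        using norm_triangle_ineq[of "(z $ i / of_real \<rho>) ^ n" "h z"] by simp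
    next
      assume *: "(\<forall>j\<in>insert i J. norm (z $ j) \<le> s \<or> t \<le> norm (z $ j)) \<and> (\<exists>j\<in>insert i J. t \<le> norm (z $ j))"
      show "M \<le> norm ((z $ i / of_real \<rho>) ^ n + h z)"
      proof (cases "t \<le> norm (z $ i)")
        case True
        then have "(t / \<rho>) ^ n \<le> norm ((z $ i / of_real \<rho>) ^ n)"
          unfolding ni using \<rho> assms by (intro power_mono divide_right_mono) auto
        then show ?thesis
          using n(2) B[OF z] norm_diff_ineq[of "(z $ i / of_real \<rho>) ^ n" "h z"] by linarith
      next
        case False
        then have "norm ((z $ i / of_real \<rho>) ^ n) \<le> 1" "M + 1 \<le> norm (h z)"
          using lo IH[OF z] * by (auto simp: h_def)
        then show ?thesis
          using norm_diff_ineq[of "h z" "(z $ i / of_real \<rho>) ^ n"] by (simp add: add.commute)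
      qed
    }
  qed
qed

text \<open>Two shears. The first gives coordinate \<open>i2\<close> modulus at least
  \<open>t1 > s\<close> on all of \<open>D\<close>: either another coordinate is at least
  \<open>t\<close> and its powers dominate, or all others are at most \<open>s\<close>, and then
  coordinate \<open>i2\<close> is itself at least \<open>t\<close> and barely changes. A high power
  of coordinate \<open>i2\<close> then makes coordinate \<open>i1\<close> as large as
  desired.\<close>

lemma automorphism_pushing_coordinate:
  fixes D :: "(complex ^ 'k) set"
  assumes "i1 \<noteq> i2" "0 \<le> s'" "s' < s" "s < t" "0 < e" "D \<subseteq> polydisc R"
    and gap: "\<And>z j. z \<in> D \<Longrightarrow> norm (z $ j) \<le> s \<or> t \<le> norm (z $ j)"
    and far: "\<And>z. z \<in> D \<Longrightarrow> z \<notin> polydisc s"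
  shows "\<exists>A. automorphism A \<and> near_id s' e A \<and> (\<forall>z\<in>D. W \<le> norm (A z $ i1))"
proof -
  \<comment> \<open>Two factors share \<open>e\<close>, their composition needs the margin
    \<open>s - s'\<close>, and coordinate \<open>i2\<close> must not drop below the midpoint of
    \<open>s\<close> and \<open>t\<close>.\<close>
  define \<epsilon> where "\<epsilon> = min (e / 2) (min (s - s') ((t - s) / 2))"
  have \<epsilon>: "0 < \<epsilon>" "2 * \<epsilon> \<le> e" "s' + \<epsilon> \<le> s" "\<epsilon> \<le> (t - s) / 2"
  proof -
    have "\<epsilon> \<le> e / 2" "\<epsilon> \<le> s - s'" "\<epsilon> \<le> (t - s) / 2"
      unfolding \<epsilon>_def
      using min.cobounded1[of "e / 2" "min (s - s') ((t - s) / 2)"]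
        min.cobounded2[of "e / 2" "min (s - s') ((t - s) / 2)"]
        min.cobounded1[of "s - s'" "(t - s) / 2"] min.cobounded2[of "s - s'" "(t - s) / 2"]
      by linarith+
    then show "2 * \<epsilon> \<le> e" "s' + \<epsilon> \<le> s" "\<epsilon> \<le> (t - s) / 2" by linarith+
    show "0 < \<epsilon>" using assms(3-5) by (simp add: \<epsilon>_def)
  qed
  have "0 \<le> s" using assms(2,3) by simp
  have R: "norm (z $ j) \<le> R" if "z \<in> D" for z j using assms(6) that polydiscD by blast
  \<comment> \<open>The radius \<open>max R s\<close> covers both \<open>D\<close> and
    \<open>polydisc s\<close>; the lower bound \<open>R + t\<close> absorbs a coordinate
    \<open>i2\<close> of modulus up to \<open>R\<close>.\<close>
  obtain c N where cN: "\<And>z :: complex ^ 'k. z \<in> polydisc (max R s) \<Longrightarrow>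
      ((\<forall>j\<in>-{i2}. norm (z $ j) \<le> s) \<longrightarrow> norm (\<Sum>j\<in>-{i2}. c j * (z $ j) ^ N j) \<le> \<epsilon>) \<and>
      ((\<forall>j\<in>-{i2}. norm (z $ j) \<le> s \<or> t \<le> norm (z $ j)) \<and> (\<exists>j\<in>-{i2}. t \<le> norm (z $ j)) \<longrightarrow>
        R + t \<le> norm (\<Sum>j\<in>-{i2}. c j * (z $ j) ^ N j))"
    using power_sum_gap[OF \<open>0 \<le> s\<close> \<open>s < t\<close> \<epsilon>(1), of "max R s" "-{i2}" "R + t"] by blast
  define h where "h z = (\<Sum>j\<in>-{i2}. c j * (z $ j) ^ N j)" for z :: "complex ^ 'k"
  define A where "A = power_shear (-{i2}) c N (axis i2 1)"
  have A_nth: "A z $ j = (if j = i2 then z $ i2 + h z else z $ j)" for z j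
    by (simp add: A_def power_shear_def h_def axis_def)
  have ax: "axis i2 (1::complex) $ j = 0" if "j \<in> -{i2}" for j using that by (simp add: axis_def)
  have auto_A: "automorphism A" unfolding A_def by (rule automorphism_power_shear) (rule ax)
  have near_A: "near_id s \<epsilon> A" unfolding A_def
  proof (rule near_id_power_shear, rule ax)
    fix z :: "complex ^ 'k" assume z: "z \<in> polydisc s"
    then have "z \<in> polydisc (max R s)" using polydisc_mono[of s "max R s"] by auto
    from cN[OF this] show "norm (\<Sum>j\<in>-{i2}. c j * (z $ j) ^ N j) * norm (axis i2 1 :: complex ^ 'k) \<le> \<epsilon>"
      using polydiscD[OF z] by simp
  qed
  define t1 where "t1 = (s + t) / 2"
  have A_i2: "t1 \<le> norm (A z $ i2)" if z: "z \<in> D" for z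
  proof -
    have zm: "z \<in> polydisc (max R s)" using assms(6) z polydisc_mono[of R "max R s"] by auto
    show ?thesis
    proof (cases "\<exists>j\<in>-{i2}. t \<le> norm (z $ j)")
      case True
      then have "R + t \<le> norm (h z)" using cN[OF zm] gap[OF z] by (auto simp: h_def)
      then have "t \<le> norm (h z + z $ i2)"
        using norm_diff_ineq[of "h z" "z $ i2"] R[OF z, of i2] by simp
      then show ?thesis using \<open>s < t\<close> by (simp add: A_nth t1_def add.commute)
    next
      case False
      then have le: "\<forall>j\<in>-{i2}. norm (z $ j) \<le> s" using gap[OF z] by blast
      then have "norm (h z) \<le> \<epsilon>" using cN[OF zm] by (auto simp: h_def)
      moreover have "t \<le> norm (z $ i2)"
        using far[OF z] gap[OF z] le by (fastforce simp: polydisc_def)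
      ultimately have "t - \<epsilon> \<le> norm (z $ i2 + h z)"
        using norm_diff_ineq[of "z $ i2" "h z"] by simp
      then show ?thesis using \<epsilon> by (simp add: A_nth t1_def)
    qed
  qed
  define \<rho> where "\<rho> = (s + t1) / 2"
  have \<rho>: "0 \<le> s" "s < \<rho>" "\<rho> < t1" "0 < \<rho>" using \<open>0 \<le> s\<close> \<open>s < t\<close> by (auto simp: \<rho>_def t1_def field_simps)
  \<comment> \<open>\<open>W + R\<close> leaves at least \<open>W\<close> after the original
    coordinate \<open>i1\<close> is added.\<close>
  obtain n where n: "(s / \<rho>) ^ n \<le> \<epsilon>" "W + R \<le> (t1 / \<rho>) ^ n"
    using power_gap[OF \<rho>(1-3) \<epsilon>(1)] by blast
  define B where "B = power_shear {i2} (\<lambda>_. 1 / of_real \<rho> ^ n) (\<lambda>_. n) (axis i1 1)"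
  have ax1: "axis i1 (1::complex) $ j = 0" if "j \<in> {i2}" for j
    using that assms(1) by (simp add: axis_def)
  have norm_term: "norm (1 / of_real \<rho> ^ n * w ^ n) = (norm w / \<rho>) ^ n" for w :: complex
    using \<rho> by (simp add: norm_mult norm_divide norm_power power_divide)
  have auto_B: "automorphism B" unfolding B_def by (rule automorphism_power_shear) (rule ax1)
  have near_B: "near_id s \<epsilon> B" unfolding B_def
  proof (rule near_id_power_shear, rule ax1)
    fix z :: "complex ^ 'k" assume z: "z \<in> polydisc s"
    have "(norm (z $ i2) / \<rho>) ^ n \<le> (s / \<rho>) ^ n"
      using polydiscD[OF z] \<rho> by (intro power_mono divide_right_mono) auto
    then show "norm (\<Sum>j\<in>{i2}. 1 / of_real \<rho> ^ n * (z $ j) ^ n) * norm (axis i1 1 :: complex ^ 'k) \<le> \<epsilon>"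
      using n(1) by (simp add: norm_term del: times_divide_eq_left)
  qed
  have "W \<le> norm ((B \<circ> A) z $ i1)" if z: "z \<in> D" for z
  proof -
    let ?g = "1 / of_real \<rho> ^ n * (A z $ i2) ^ n"
    have "(t1 / \<rho>) ^ n \<le> (norm (A z $ i2) / \<rho>) ^ n"
      using A_i2[OF z] \<rho> by (intro power_mono divide_right_mono) auto
    then have "W + R \<le> norm ?g" using n(2) by (simp only: norm_term)
    moreover have "(B \<circ> A) z $ i1 = z $ i1 + ?g"
      using assms(1) by (simp add: B_def power_shear_def axis_def A_nth)
    ultimately show ?thesis
      using R[OF z, of i1] norm_diff_ineq[of ?g "z $ i1"] by (simp add: add.commute)
  qed
  moreover have "near_id s' e (B \<circ> A)"
    using near_id_compose[OF auto_A near_A auto_B near_B, of s'] \<epsilon> by (auto elim!: near_id_subset)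
  ultimately show ?thesis using automorphism_compose[OF auto_A auto_B] by blast
qed

section \<open>Exceptional sets of small measure and the return of a single point\<close>

lemma compact_Collect_level:
  fixes F :: "complex ^ 'k \<Rightarrow> complex ^ 'k"
  assumes "automorphism F" "compact L"
  shows "compact {x\<in>L. \<bar>norm (F x $ j) - \<rho>\<bar> \<le> \<theta>}"
proof -
  have "closed {x. \<bar>norm (F x $ j) - \<rho>\<bar> \<le> \<theta>}"
    using automorphism_continuous_on[OF assms(1)] by (intro closed_Collect_le continuous_intros)
  then have "compact (L \<inter> {x. \<bar>norm (F x $ j) - \<rho>\<bar> \<le> \<theta>})"
    using assms(2) by (rule compact_Int_closed[rotated])
  then show ?thesis by (simp add: Int_def)
qed

text \<open>For decreasing widths these compact sets shrink into the preimage of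
  \<open>{z. norm (z $ j) = \<rho>}\<close>, which is negligible, so their measures tend to
  0.\<close>

lemma measure_near_level_set_small:
  fixes F :: "complex ^ 'k \<Rightarrow> complex ^ 'k"
  assumes F: "automorphism F" and L: "compact L" and "0 < \<rho>" "0 < \<eta>"
  shows "\<exists>\<theta>>0. measure lebesgue {x\<in>L. \<bar>norm (F x $ j) - \<rho>\<bar> \<le> \<theta>} < \<eta>"
proof -
  define A where "A m = {x\<in>L. \<bar>norm (F x $ j) - \<rho>\<bar> \<le> inverse (real (Suc m))}" for m
  have A: "A m \<in> lmeasurable" for m
    unfolding A_def by (intro lmeasurable_compact compact_Collect_level F L)
  have "(\<Inter>m. A m) \<subseteq> F -` {z. norm (z $ j) = \<rho>}"
  proof
    fix x assume "x \<in> (\<Inter>m. A m)"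
    then have "\<bar>norm (F x $ j) - \<rho>\<bar> \<le> inverse (real (Suc m))" for m by (auto simp: A_def)
    then have "\<bar>norm (F x $ j) - \<rho>\<bar> \<le> 0"
      by (intro LIMSEQ_le_const[OF LIMSEQ_inverse_real_of_nat]) auto
    then show "x \<in> F -` {z. norm (z $ j) = \<rho>}" by simp
  qed
  then have "negligible (\<Inter>m. A m)"
    using negligible_vimage_automorphism[OF F negligible_norm_nth_eq[OF \<open>0 < \<rho>\<close>]] negligible_subset by blast
  then have 0: "measure lebesgue (\<Inter>m. A m) = 0" by (rule negligible_imp_measure0)
  have "(\<lambda>m. measure lebesgue (A m)) \<longlonglongrightarrow> measure lebesgue (\<Inter>m. A m)"
  proof (rule Lim_measure_decseq)
    show "range A \<subseteq> sets lebesgue" using A by (auto simp: fmeasurableD)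
    show "decseq A"
      unfolding decseq_def A_def by (auto elim!: order_trans intro!: le_imp_inverse_le)
    show "emeasure lebesgue (A i) \<noteq> \<infinity>" for i
      using fmeasurableD2[OF A] by simp
  qed
  then have "\<forall>\<^sub>F m in sequentially. measure lebesgue (A m) < \<eta>"
    unfolding 0 using \<open>0 < \<eta>\<close> by (rule order_tendstoD)
  then obtain m where "measure lebesgue (A m) < \<eta>"
    unfolding eventually_sequentially by blast
  then show ?thesis
    unfolding A_def by (intro exI[of _ "inverse (real (Suc m))"]) auto
qed

text \<open>\<open>B = A2 \<circ> A1 \<circ> A0\<close>. The factor \<open>A0\<close> sends the
  point \<open>J x0\<close> and the image of \<open>L\<close>, apart from thin annuli, far out in
  coordinate \<open>i1\<close>; \<open>A1\<close> and \<open>A2\<close> bring the point back. Since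
  \<open>A2\<close> acts through a high power of coordinate \<open>i2\<close>, it can bring other
  far points back only if that coordinate has modulus close to 3/2, which happens on a set of small
  measure.\<close>

lemma automorphism_moving_point_into_polydisc:
  fixes J :: "complex ^ 'k \<Rightarrow> complex ^ 'k"
  assumes card: "2 \<le> CARD('k)" and J: "automorphism J" and L: "compact L"
    and LJ: "\<And>x. x \<in> L \<Longrightarrow> J x \<notin> polydisc 1" and x0: "J x0 \<notin> polydisc 1"
    and "0 < \<epsilon>" "0 < \<eta>"
  shows "\<exists>B. automorphism B \<and> near_id 1 \<epsilon> B \<and> B (J x0) \<in> polydisc 2 \<and>
    measure lebesgue {x\<in>L. B (J x) \<in> polydisc W} < \<eta>"
proof -
  obtain i1 i2 :: 'k where i12: "i1 \<noteq> i2"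
  proof -
    have "\<not> CARD('k) \<le> Suc 0" using card by simp
    then have "\<exists>i1 i2 :: 'k. i1 \<noteq> i2" by (metis UNIV_I card_le_Suc0_iff_eq finite)
    then show ?thesis using that by blast
  qed
  \<comment> \<open>At least 2, so that the coordinate \<open>a\<close> below has modulus at least
    3, beyond \<open>s\<close>.\<close>
  define W' where "W' = max W 2"
  have J_cont: "continuous_on X J" for X using J by (rule automorphism_continuous_on)
  have "compact (insert (J x0) (J ` L))"
    using L J_cont by (intro compact_insert compact_continuous_image) auto
  moreover have "insert (J x0) (J ` L) \<inter> polydisc 1 = {}" using LJ x0 by auto
  ultimately obtain \<rho>1 where \<rho>1: "1 < \<rho>1" "insert (J x0) (J ` L) \<inter> polydisc \<rho>1 = {}"
    using compact_disjoint_polydisc by blast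
  \<comment> \<open>Only finitely many radii are excluded: the moduli of the coordinates of
    \<open>J x0\<close>, which must stay off the removed annuli.\<close>
  have "infinite {1<..<min \<rho>1 (3/2)}" using \<rho>1 by (simp add: infinite_Ioo)
  then have "{1<..<min \<rho>1 (3/2)} - (\<lambda>j. norm (J x0 $ j)) ` UNIV \<noteq> {}"
    by (metis Diff_eq_empty_iff finite_imageI finite_subset finite)
  then obtain \<rho> where \<rho>: "1 < \<rho>" "\<rho> < \<rho>1" "\<rho> < 3/2" "\<And>j. norm (J x0 $ j) \<noteq> \<rho>" by fastforce

  \<comment> \<open>Half of \<open>\<eta>\<close> is divided among the annuli of all coordinates;
    the other half is for the level set of \<open>Y\<close> below.\<close>
  define \<eta>' where "\<eta>' = \<eta> / (2 * real CARD('k))"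
  have "0 < \<eta>'" using \<open>0 < \<eta>\<close> by (simp add: \<eta>'_def)
  then have "\<forall>j. \<exists>\<theta>>0. measure lebesgue {x\<in>L. \<bar>norm (J x $ j) - \<rho>\<bar> \<le> \<theta>} < \<eta>'"
    using measure_near_level_set_small[OF J L] \<rho> by auto
  from choice[OF this] obtain \<theta>' where \<theta>': "\<And>j. 0 < \<theta>' j"
      "\<And>j. measure lebesgue {x\<in>L. \<bar>norm (J x $ j) - \<rho>\<bar> \<le> \<theta>' j} < \<eta>'" by blast
  \<comment> \<open>One width for all coordinates: it keeps the annulus between 1 and 3/2, is at
    most each \<open>\<theta>' j\<close>, and leaves out the coordinates of
    \<open>J x0\<close>.\<close>
  define \<theta>s where "\<theta>s = {(\<rho> - 1) / 2, (3/2 - \<rho>) / 2} \<union> range \<theta>' \<union> range (\<lambda>j. \<bar>norm (J x0 $ j) - \<rho>\<bar>)"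
  define \<theta> where "\<theta> = Min \<theta>s"
  have fin: "finite \<theta>s" by (simp add: \<theta>s_def)
  have "0 < \<theta>" unfolding \<theta>_def
    by (subst Min_gr_iff[OF fin]) (use \<theta>' \<rho> in \<open>auto simp: \<theta>s_def\<close>)
  have \<theta>_le: "\<theta> \<le> y" if "y \<in> \<theta>s" for y using fin that by (simp add: \<theta>_def)
  have \<theta>: "\<theta> \<le> (\<rho> - 1) / 2" "\<theta> \<le> (3/2 - \<rho>) / 2" "\<And>j. \<theta> \<le> \<theta>' j" "\<And>j. \<theta> \<le> \<bar>norm (J x0 $ j) - \<rho>\<bar>"
    by (rule \<theta>_le, simp add: \<theta>s_def)+
  define s t where "s = \<rho> - \<theta>" and "t = \<rho> + \<theta>"
  have st: "1 < s" "s < t" "t < 3/2" "s < \<rho>1" "0 \<le> s"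
    using \<open>0 < \<theta>\<close> \<theta>(1,2) \<rho> by (auto simp: s_def t_def field_simps)
  define s' where "s' = (1 + s) / 2"
  have s': "1 < s'" "s' < s" "0 \<le> s'" using st by (auto simp: s'_def)
  \<comment> \<open>\<open>A0\<close> uses \<open>2 * e\<close> of the budget, \<open>A1\<close> and
    \<open>A2\<close> use \<open>e\<close> each, and the radii 1, \<open>s'\<close> and
    \<open>s\<close> differ by enough to contain these displacements.\<close>
  define e where "e = min (\<epsilon> / 4) ((s' - 1) / 2)"
  have e: "0 < e" "4 * e \<le> \<epsilon>" "1 + 2 * e \<le> s'" "s' + e \<le> s"
  proof -
    have "e \<le> \<epsilon> / 4" "e \<le> (s' - 1) / 2" unfolding e_def by (rule min.cobounded1 min.cobounded2)+
    then show "4 * e \<le> \<epsilon>" "1 + 2 * e \<le> s'" "s' + e \<le> s" using s' by (auto simp: s'_def field_simps)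
    show "0 < e" using \<open>0 < \<epsilon>\<close> s' by (simp add: e_def)
  qed

  define L' where "L' = {x\<in>L. \<forall>j. \<theta> \<le> \<bar>norm (J x $ j) - \<rho>\<bar>}"
  have L'_sub: "L' \<subseteq> L" by (auto simp: L'_def)
  define D where "D = insert (J x0) (J ` L')"
  have gap: "norm (z $ j) \<le> s \<or> t \<le> norm (z $ j)" if "z \<in> D" for z j
  proof -
    have "\<theta> \<le> \<bar>norm (z $ j) - \<rho>\<bar>" using that \<theta>(4) by (auto simp: D_def L'_def)
    then show ?thesis by (auto simp: s_def t_def)
  qed
  have far: "z \<notin> polydisc s" if "z \<in> D" for z
  proof -
    have "z \<notin> polydisc \<rho>1" using that \<rho>1(2) L'_sub by (auto simp: D_def)
    then show ?thesis using polydisc_mono[of s \<rho>1] st by auto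
  qed
  obtain R where R: "0 < R" "insert (J x0) (J ` L) \<subseteq> polydisc R"
    using compact_subset_polydisc[OF \<open>compact (insert (J x0) (J ` L))\<close>] by blast
  have DR: "D \<subseteq> polydisc R" using R(2) L'_sub by (auto simp: D_def)
  obtain A0 where A0: "automorphism A0" "near_id s' (2 * e) A0"
      "\<And>z. z \<in> D \<Longrightarrow> W' + 1 \<le> norm (A0 z $ i1)"
    using automorphism_pushing_coordinate[OF i12 s'(3,2) st(2) _ DR gap far, of "2 * e" "W' + 1"] e(1)
    by auto

  define q where "q = A0 (J x0)"
  define a where "a = q $ i1"
  have a: "3 \<le> norm a" "W' + 1 \<le> norm a"
    using A0(3)[of "J x0"] by (auto simp: a_def q_def D_def W'_def)
  \<comment> \<open>\<open>A1\<close> changes the coordinate \<open>i2\<close> of \<open>q\<close> to \<open>3/2\<close> and the others, except \<open>i1\<close>, to \<open>0\<close>;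
    afterwards \<open>A2\<close> cancels the coordinate \<open>a\<close> at \<open>i1\<close>.\<close>
  define v where "v = (\<chi> j. if j = i1 then 0 else if j = i2 then 3/2 - q $ j else - (q $ j))"
  have v: "v $ j = 0" if "j \<in> {i1}" for j using that by (simp add: v_def)
  have "0 < e / (norm v + 1)" using e by (simp add: add_nonneg_pos)
  then obtain n where n: "(s / norm a) ^ n \<le> e / (norm v + 1)"
    using power_gap[of s "norm a" "norm a + 1" "e / (norm v + 1)" 0] st a(1) by auto
  \<comment> \<open>The factor \<open>(z $ i1 / a) ^ n\<close> equals 1 at \<open>q\<close> and is
    tiny on \<open>polydisc s\<close>, as \<open>s < norm a\<close>.\<close>
  define A1 where "A1 = power_shear {i1} (\<lambda>_. 1 / a ^ n) (\<lambda>_. n) v"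
  have auto_A1: "automorphism A1" unfolding A1_def by (rule automorphism_power_shear) (rule v)
  have near_A1: "near_id s e A1" unfolding A1_def
  proof (rule near_id_power_shear, rule v)
    fix z :: "complex ^ 'k" assume z: "z \<in> polydisc s"
    have "norm (\<Sum>j\<in>{i1}. 1 / a ^ n * (z $ j) ^ n) = (norm (z $ i1) / norm a) ^ n"
      by (simp add: norm_divide norm_power power_divide)
    also have "\<dots> \<le> (s / norm a) ^ n"
      using polydiscD[OF z] by (intro power_mono divide_right_mono) auto
    finally have "norm (\<Sum>j\<in>{i1}. 1 / a ^ n * (z $ j) ^ n) * norm v \<le> e / (norm v + 1) * norm v"
      using n by (intro mult_right_mono) auto
    also have "\<dots> = e * (norm v / (norm v + 1))" by simp
    also have "\<dots> \<le> e * 1"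
      using e by (intro mult_left_mono) (auto simp: divide_simps add_nonneg_pos)
    finally show "norm (\<Sum>j\<in>{i1}. 1 / a ^ n * (z $ j) ^ n) * norm v \<le> e" by simp
  qed
  have A1_nth: "A1 z $ i1 = z $ i1" for z by (simp add: A1_def power_shear_def v_def)
  have a0: "a \<noteq> 0" using a by auto
  have A1_q: "A1 q $ j = (if j = i1 then a else if j = i2 then 3/2 else 0)" for j
    using a0 i12 by (auto simp: A1_def power_shear_def v_def a_def [symmetric] power_divide [symmetric])

  define Y where "Y = A1 \<circ> A0 \<circ> J"
  have auto_Y: "automorphism Y"
    unfolding Y_def by (intro automorphism_compose auto_A1 A0(1) J)
  have "compact (Y ` L)"
    using L automorphism_continuous_on[OF auto_Y] by (rule compact_continuous_image[rotated])
  then obtain R2 where R2: "0 < R2" "Y ` L \<subseteq> polydisc R2" using compact_subset_polydisc by blast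
  obtain \<theta>2 where \<theta>2: "0 < \<theta>2" "measure lebesgue {x\<in>L. \<bar>norm (Y x $ i2) - 3/2\<bar> \<le> \<theta>2} < \<eta> / 2"
    using measure_near_level_set_small[OF auto_Y L, of "3/2" "\<eta> / 2" i2] \<open>0 < \<eta>\<close> by auto
  \<comment> \<open>Covers two kinds of points: those in \<open>polydisc s\<close>, for closeness to
    the identity, and those whose coordinate \<open>i2\<close> lies below the annulus about
    3/2.\<close>
  define s2 where "s2 = max s (3/2 - \<theta>2)"
  have s2: "0 \<le> s2" "s2 < 3/2" "3/2 < 3/2 + \<theta>2"
    using st(3,2,5) \<theta>2(1) unfolding s2_def max_def by (simp_all split: if_split)
  have "0 < min e (1/2) / norm a" using e a0 by simp
  \<comment> \<open>Below the annulus the term of \<open>A2\<close> changes coordinate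
    \<open>i1\<close> by at most 1/2, too little to bring it back; above the annulus it is at least
    \<open>R2 + W' + 1\<close> and overshoots.\<close>
  then obtain m where m: "(s2 / (3/2)) ^ m \<le> min e (1/2) / norm a"
      "(R2 + W' + 1) / norm a \<le> ((3/2 + \<theta>2) / (3/2)) ^ m"
    using power_gap[OF s2] by blast
  then have m': "norm a * (s2 / (3/2)) ^ m \<le> min e (1/2)"
      "R2 + W' + 1 \<le> norm a * ((3/2 + \<theta>2) / (3/2)) ^ m"
    using a0 by (simp_all add: field_simps)
  define A2 where "A2 = power_shear {i2} (\<lambda>_. - a / (3/2) ^ m) (\<lambda>_. m) (axis i1 1)"
  have ax: "axis i1 (1::complex) $ j = 0" if "j \<in> {i2}" for j
    using that i12 by (simp add: axis_def)
  have norm_A2_term: "norm (- a / (3/2) ^ m * w ^ m) = norm a * (norm w / (3/2)) ^ m" for w :: complex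
    by (simp add: norm_mult norm_divide norm_power power_divide)
  have auto_A2: "automorphism A2" unfolding A2_def by (rule automorphism_power_shear) (rule ax)
  have near_A2: "near_id s e A2" unfolding A2_def
  proof (rule near_id_power_shear, rule ax)
    fix z :: "complex ^ 'k" assume z: "z \<in> polydisc s"
    have "norm (z $ i2) \<le> s2" using polydiscD[OF z, of i2] by (simp add: s2_def)
    then have "norm a * (norm (z $ i2) / (3/2)) ^ m \<le> norm a * (s2 / (3/2)) ^ m"
      by (intro mult_left_mono power_mono divide_right_mono) auto
    then show "norm (\<Sum>j\<in>{i2}. - a / (3/2) ^ m * (z $ j) ^ m) * norm (axis i1 1 :: complex ^ 'k) \<le> e"
      using m'(1) norm_A2_term[of "z $ i2"] by simp
  qed
  have A2_nth: "A2 z $ j = (if j = i1 then z $ i1 + (- a / (3/2) ^ m * (z $ i2) ^ m) else z $ j)" for z j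
    by (simp add: A2_def power_shear_def axis_def)

  define B where "B = (A2 \<circ> A1) \<circ> A0"
  have auto_21: "automorphism (A2 \<circ> A1)" by (intro automorphism_compose auto_A1 auto_A2)
  have "near_id s' (e + e) (A2 \<circ> A1)"
    using e by (intro near_id_compose[OF auto_A1 near_A1 auto_A2 near_A2]) auto
  then have near_21: "near_id s' (2 * e) (A2 \<circ> A1)" by (simp only: mult_2)
  have "near_id 1 (2 * e + 2 * e) B" unfolding B_def
    using e by (intro near_id_compose[OF A0(1,2) auto_21 near_21]) auto
  then have near_B: "near_id 1 \<epsilon> B" using e by (elim near_id_subset) auto
  have auto_B: "automorphism B" unfolding B_def by (intro automorphism_compose A0(1) auto_21)

  \<comment> \<open>At \<open>A1 q\<close> coordinate \<open>i2\<close> is exactly 3/2, so the term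
    of \<open>A2\<close> equals \<open>- a\<close> and cancels coordinate \<open>i1\<close>.\<close>
  have "B (J x0) $ j = (if j = i2 then 3/2 else 0)" for j
    using i12 a0 by (auto simp: B_def A2_nth A1_q q_def [symmetric])
  then have B_x0: "B (J x0) \<in> polydisc 2" by (auto simp: polydisc_def)

  define bad where "bad j = {x\<in>L. \<bar>norm (J x $ j) - \<rho>\<bar> \<le> \<theta>' j}" for j
  define bad2 where "bad2 = {x\<in>L. \<bar>norm (Y x $ i2) - 3/2\<bar> \<le> \<theta>2}"
  have bad_sub: "{x\<in>L. B (J x) \<in> polydisc W} \<subseteq> (\<Union>j. bad j) \<union> bad2"
  proof (rule subsetI, rule ccontr)
    fix x assume "x \<in> {x\<in>L. B (J x) \<in> polydisc W}" and not_bad: "x \<notin> (\<Union>j. bad j) \<union> bad2"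
    then have x: "x \<in> L" "B (J x) \<in> polydisc W" by auto
    have "\<theta>' j < \<bar>norm (J x $ j) - \<rho>\<bar>" for j
      using not_bad x(1) by (simp add: bad_def not_le)
    then have "\<theta> \<le> \<bar>norm (J x $ j) - \<rho>\<bar>" for j
      using \<theta>(3)[of j] by (meson less_imp_le order_trans)
    then have "x \<in> L'" using x(1) by (simp add: L'_def)
    then have "W' + 1 \<le> norm (A0 (J x) $ i1)" by (intro A0(3)) (simp add: D_def)
    then have y1: "W' + 1 \<le> norm (Y x $ i1)" by (simp add: Y_def A1_nth)
    have y1': "norm (Y x $ i1) \<le> R2" using R2(2) x(1) polydiscD by blast
    let ?g = "- a / (3/2) ^ m * (Y x $ i2) ^ m"
    have "norm (Y x $ i1 + ?g) \<le> W"
      using polydiscD[OF x(2), of i1] by (simp add: B_def Y_def A2_nth)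
    then have le: "norm (Y x $ i1 + ?g) \<le> W'" by (simp add: W'_def)
    have "\<theta>2 < \<bar>norm (Y x $ i2) - 3/2\<bar>" using not_bad x(1) by (auto simp: bad2_def)
    then consider "norm (Y x $ i2) \<le> s2" | "3/2 + \<theta>2 \<le> norm (Y x $ i2)"
      by (fastforce simp: s2_def)
    then show False
    proof cases
      case 1
      then have "norm a * (norm (Y x $ i2) / (3/2)) ^ m \<le> norm a * (s2 / (3/2)) ^ m"
        by (intro mult_left_mono power_mono divide_right_mono) auto
      then have "norm ?g \<le> 1/2" using m'(1) by (simp only: norm_A2_term)
      then show False using le y1 norm_diff_ineq[of "Y x $ i1" ?g] by linarith
    next
      case 2
      then have "norm a * ((3/2 + \<theta>2) / (3/2)) ^ m \<le> norm a * (norm (Y x $ i2) / (3/2)) ^ m"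
        using \<theta>2 by (intro mult_left_mono power_mono divide_right_mono) auto
      then have "R2 + W' + 1 \<le> norm ?g" using m'(2) by (simp only: norm_A2_term)
      then show False
        using le y1' norm_diff_ineq[of ?g "Y x $ i1"] by (simp add: add.commute)
    qed
  qed
  have bad: "bad j \<in> lmeasurable" for j
    unfolding bad_def by (intro lmeasurable_compact compact_Collect_level J L)
  have bad2: "bad2 \<in> lmeasurable"
    unfolding bad2_def by (intro lmeasurable_compact compact_Collect_level auto_Y L)
  have U: "(\<Union>j. bad j) \<in> lmeasurable" using bad by (intro fmeasurable.finite_UN) auto
  have "{x\<in>L. B (J x) \<in> polydisc W} = L \<inter> (B \<circ> J) -` polydisc W" by auto
  moreover have "compact \<dots>"
    using L by (intro compact_Int compact_vimage_automorphism automorphism_compose J auto_B compact_polydisc)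
  ultimately have "measure lebesgue {x\<in>L. B (J x) \<in> polydisc W} \<le> measure lebesgue ((\<Union>j. bad j) \<union> bad2)"
    using bad_sub U bad2 by (intro measure_mono_fmeasurable) (auto intro: fmeasurableD lmeasurable_compact)
  also have "\<dots> \<le> measure lebesgue (\<Union>j. bad j) + measure lebesgue bad2"
    using U bad2 by (intro measure_Un_le) (auto intro: fmeasurableD)
  also have "measure lebesgue (\<Union>j. bad j) \<le> (\<Sum>j\<in>UNIV. measure lebesgue (bad j))"
    using bad by (intro measure_UNION_le) (auto intro: fmeasurableD)
  also have "\<dots> \<le> (\<Sum>j\<in>(UNIV::'k set). \<eta>')"
    using \<theta>'(2) by (intro sum_mono) (simp add: bad_def less_imp_le)
  also have "\<dots> = \<eta> / 2" by (simp add: \<eta>'_def)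
  also have "measure lebesgue bad2 < \<eta> / 2" using \<theta>2(2) by (simp add: bad2_def)
  finally show ?thesis using auto_B near_B B_x0 by auto
qed

section \<open>The push-out construction\<close>

text \<open>The correction is made in the coordinates of \<open>G\<close>:
  \<open>F' = inv G \<circ> B \<circ> G \<circ> F\<close>, with \<open>B\<close> close to the
  identity on \<open>polydisc 1\<close>, which corresponds to \<open>K\<close>. The point moved back
  is chosen in \<open>N\<close>, unless \<open>N\<close> already lies in the preimage of
  \<open>K\<close>.\<close>

lemma automorphism_modification_step:
  fixes F G :: "complex ^ 'k \<Rightarrow> complex ^ 'k"
  assumes card: "2 \<le> CARD('k)" and F: "automorphism F" and G: "automorphism G"
    and K: "K = G -` polydisc 1" and K': "compact K'" "G -` polydisc 2 \<subseteq> K'"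
    and N: "N \<noteq> {}" and "0 < \<mu>"
  shows "\<exists>F'. automorphism F' \<and>
    (\<forall>z\<in>K. norm (F' (inv F z) - z) \<le> \<mu> \<and> norm (F (inv F' z) - z) \<le> \<mu> \<and>
      norm (inv F' z - inv F z) \<le> \<mu>) \<and>
    measure lebesgue {x\<in>cball 0 R. F x \<notin> K \<and> F' x \<in> K'} \<le> \<mu> \<and>
    (\<exists>x\<in>N. F x \<in> K \<or> F' x \<in> K')"
proof -
  define J where "J = G \<circ> F"
  have J: "automorphism J" unfolding J_def by (rule automorphism_compose[OF F G])
  have in_K: "F x \<in> K \<longleftrightarrow> J x \<in> polydisc 1" for x by (simp add: K J_def)
  have "compact K" unfolding K by (rule compact_vimage_automorphism[OF G compact_polydisc])
  then have "compact (F -` K)" by (rule compact_vimage_automorphism[OF F])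
  \<comment> \<open>\<open>Q\<close> need not be compact; its inner approximation \<open>L\<close>
    below loses measure at most \<open>\<mu> / 2\<close>.\<close>
  define Q where "Q = cball 0 R - F -` K"
  have Q: "Q \<in> sets lebesgue"
    unfolding Q_def using \<open>compact (F -` K)\<close>
    by (intro sets.Diff lmeasurable_compact[THEN fmeasurableD]) auto
  obtain L where L: "closed L" "L \<subseteq> Q" "Q - L \<in> lmeasurable" "emeasure lebesgue (Q - L) < ennreal (\<mu> / 2)"
    using sets_lebesgue_inner_closed[OF Q, of "\<mu> / 2"] \<open>0 < \<mu>\<close> by auto
  have "compact L"
    using L(1,2) bounded_subset[of "cball 0 R" L] by (auto simp: compact_eq_bounded_closed Q_def)
  have QL: "measure lebesgue (Q - L) \<le> \<mu> / 2"
    using L(3,4) \<open>0 < \<mu>\<close> by (simp add: emeasure_eq_measure2 ennreal_less_iff less_imp_le)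
  \<comment> \<open>If \<open>N\<close> lies in the preimage of \<open>K\<close>, it is met already
    and \<open>x0\<close> is an arbitrary point outside.\<close>
  have "\<exists>x0. J x0 \<notin> polydisc 1 \<and> (x0 \<in> N \<or> N \<subseteq> F -` K)"
  proof (cases "N \<subseteq> F -` K")
    case True
    have "J (inv J (\<chi> i. 2)) \<notin> polydisc 1" using J by (simp add: polydisc_def)
    then show ?thesis using True by blast
  next
    case False
    then show ?thesis using in_K by auto
  qed
  then obtain x0 where x0: "J x0 \<notin> polydisc 1" "x0 \<in> N \<or> N \<subseteq> F -` K" by blast
  have "compact (G ` K')"
    using K'(1) automorphism_continuous_on[OF G] by (rule compact_continuous_image[rotated])
  then obtain W where W: "G ` K' \<subseteq> polydisc W" using compact_subset_polydisc by blast
  \<comment> \<open>Uniform continuity carries closeness in the coordinates of \<open>G\<close> back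
    to the original ones. Radius 2 accommodates \<open>polydisc 1\<close> together with
    displacements up to 1.\<close>
  have unif: "\<exists>\<delta>>0. \<forall>u\<in>polydisc 2. \<forall>w\<in>polydisc 2. norm (u - w) \<le> \<delta> \<longrightarrow> norm (h u - h w) \<le> \<mu>"
    if "automorphism h" for h :: "complex ^ 'k \<Rightarrow> complex ^ 'k"
  proof -
    have "uniformly_continuous_on (polydisc 2) h"
      by (intro compact_uniformly_continuous automorphism_continuous_on that compact_polydisc)
    then obtain d where "d > 0" "\<forall>u\<in>polydisc 2. \<forall>w\<in>polydisc 2. dist w u < d \<longrightarrow> dist (h w) (h u) < \<mu>"
      unfolding uniformly_continuous_on_def using \<open>0 < \<mu>\<close> by blast
    then show ?thesis
      by (intro exI[of _ "d / 2"]) (auto simp: dist_norm norm_minus_commute intro!: less_imp_le)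
  qed
  define h2 where "h2 = inv F \<circ> inv G"
  have autos: "automorphism (inv G)" "automorphism h2"
    unfolding h2_def using F G by (auto intro: automorphism_compose automorphism_inv)
  obtain \<delta>1 where \<delta>1: "\<delta>1 > 0" "\<And>u w. u \<in> polydisc 2 \<Longrightarrow> w \<in> polydisc 2 \<Longrightarrow>
      norm (u - w) \<le> \<delta>1 \<Longrightarrow> norm (inv G u - inv G w) \<le> \<mu>"
    using unif[OF autos(1)] by blast
  obtain \<delta>2 where \<delta>2: "\<delta>2 > 0" "\<And>u w. u \<in> polydisc 2 \<Longrightarrow> w \<in> polydisc 2 \<Longrightarrow>
      norm (u - w) \<le> \<delta>2 \<Longrightarrow> norm (h2 u - h2 w) \<le> \<mu>"
    using unif[OF autos(2)] by blast
  define \<epsilon> where "\<epsilon> = min 1 (min \<delta>1 \<delta>2)"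
  have \<epsilon>: "0 < \<epsilon>" "\<epsilon> \<le> 1" "\<epsilon> \<le> \<delta>1" "\<epsilon> \<le> \<delta>2" using \<delta>1 \<delta>2 by (auto simp: \<epsilon>_def)
  have "J x \<notin> polydisc 1" if "x \<in> L" for x using L(2) that in_K by (auto simp: Q_def)
  from automorphism_moving_point_into_polydisc[OF card J \<open>compact L\<close> this x0(1) \<epsilon>(1), of "\<mu> / 2" W]
  obtain B where B: "automorphism B" "near_id 1 \<epsilon> B" "B (J x0) \<in> polydisc 2"
      "measure lebesgue {x\<in>L. B (J x) \<in> polydisc W} < \<mu> / 2"
    using \<open>0 < \<mu>\<close> by auto
  define F' where "F' = inv G \<circ> (B \<circ> J)"
  have BJ: "automorphism (B \<circ> J)" by (rule automorphism_compose[OF J B(1)])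
  have auto_F': "automorphism F'"
    unfolding F'_def by (rule automorphism_compose[OF BJ autos(1)])
  have G_F': "G (F' x) = B (J x)" for x using G by (simp add: F'_def)
  have "inv F' = (inv F \<circ> inv G) \<circ> inv B \<circ> G"
    unfolding F'_def inv_automorphism_compose[OF BJ autos(1)] inv_automorphism_compose[OF J B(1)]
    using inv_automorphism_compose[OF F G] G by (simp add: J_def o_assoc)
  then have inv_F': "inv F' z = h2 (inv B (G z))" for z by (simp add: h2_def)
  have near: "norm (F' (inv F z) - z) \<le> \<mu> \<and> norm (F (inv F' z) - z) \<le> \<mu> \<and> norm (inv F' z - inv F z) \<le> \<mu>"
    if "z \<in> K" for z
  proof -
    have Gz: "G z \<in> polydisc 1" using that by (simp add: K)
    then have *: "norm (B (G z) - G z) \<le> \<epsilon>" "norm (inv B (G z) - G z) \<le> \<epsilon>"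
      using B(2) by (auto simp: near_id_def)
    have in2: "B (G z) \<in> polydisc 2" "inv B (G z) \<in> polydisc 2" "G z \<in> polydisc 2"
      using polydisc_add[OF Gz *(1)] polydisc_add[OF Gz *(2)] polydisc_mono[of 1 2] Gz \<epsilon>(2) by auto
    have "norm (inv G (B (G z)) - inv G (G z)) \<le> \<mu>"
      using * \<epsilon> in2 by (intro \<delta>1(2)) auto
    moreover have "norm (inv G (inv B (G z)) - inv G (G z)) \<le> \<mu>"
      using * \<epsilon> in2 by (intro \<delta>1(2)) auto
    moreover have "norm (h2 (inv B (G z)) - h2 (G z)) \<le> \<mu>"
      using * \<epsilon> in2 by (intro \<delta>2(2)) auto
    moreover have "F' (inv F z) = inv G (B (G z))" using F by (simp add: F'_def J_def)
    ultimately show ?thesis using F G by (simp add: inv_F' h2_def)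
  qed
  \<comment> \<open>A point newly in \<open>K'\<close> lies either in the discarded part
    \<open>Q - L\<close> or in the set controlled by \<open>B\<close>.\<close>
  have "{x\<in>cball 0 R. F x \<notin> K \<and> F' x \<in> K'} \<subseteq> (Q - L) \<union> {x\<in>L. B (J x) \<in> polydisc W}"
    using W by (auto simp: Q_def G_F' [symmetric])
  moreover have BL: "{x\<in>L. B (J x) \<in> polydisc W} \<in> lmeasurable"
  proof -
    have "{x\<in>L. B (J x) \<in> polydisc W} = L \<inter> (B \<circ> J) -` polydisc W" by auto
    moreover have "compact \<dots>"
      by (intro compact_Int \<open>compact L\<close> compact_vimage_automorphism BJ compact_polydisc)
    ultimately show ?thesis by (simp add: lmeasurable_compact)
  qed
  moreover have "{x\<in>cball 0 R. F x \<notin> K \<and> F' x \<in> K'} = Q \<inter> F' -` K'" by (auto simp: Q_def)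
  moreover have "Q \<inter> F' -` K' \<in> sets lebesgue"
    using Q compact_vimage_automorphism[OF auto_F' K'(1)] by (intro sets.Int) (auto simp: fmeasurableD lmeasurable_compact)
  ultimately have "measure lebesgue {x\<in>cball 0 R. F x \<notin> K \<and> F' x \<in> K'} \<le>
      measure lebesgue ((Q - L) \<union> {x\<in>L. B (J x) \<in> polydisc W})"
    using L(3) by (intro measure_mono_fmeasurable) auto
  also have "\<dots> \<le> measure lebesgue (Q - L) + measure lebesgue {x\<in>L. B (J x) \<in> polydisc W}"
    using L(3) BL by (intro measure_Un_le) (auto simp: fmeasurableD)
  also have "\<dots> \<le> \<mu>" using QL B(4) by simp
  finally have small: "measure lebesgue {x\<in>cball 0 R. F x \<notin> K \<and> F' x \<in> K'} \<le> \<mu>" .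
  have "F' x0 \<in> K'" using B(3) K'(2) by (auto simp: G_F' [symmetric])
  then have "\<exists>x\<in>N. F x \<in> K \<or> F' x \<in> K'" using x0(2) N by auto
  then show ?thesis using auto_F' near small by blast
qed

text \<open>The points in question lie in a compact part of the closure of the complement of
  \<open>V\<close>, which finitely many balls of radius \<open>r / 2\<close> cover. Each of these
  meets the complement in a nonempty open set, and the one containing a given point lies in the ball
  of radius \<open>r\<close> about it.\<close>

lemma measure_ball_diff_lower_bound:
  fixes V :: "'a::euclidean_space set"
  assumes "closed V" "0 < r"
  shows "\<exists>m>0. \<forall>p\<in>cball 0 R. p \<notin> V \<longrightarrow> m \<le> measure lebesgue (ball p r - V)"
proof -
  define C where "C = cball 0 R \<inter> closure (- V)"
  define f where "f p = measure lebesgue (ball p (r / 2) - V)" for p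
  have meas: "ball p s - V \<in> lmeasurable" for p s
    using assms(1) by (intro bounded_set_imp_lmeasurable)
      (auto intro: bounded_subset[OF bounded_ball] simp: borel_closed)
  have f: "0 < f p" if "p \<in> C" for p
  proof -
    have "ball p (r / 2) \<inter> - V \<noteq> {}"
      using that \<open>0 < r\<close> open_Int_closure_eq_empty[of "ball p (r / 2)" "- V"]
      by (auto simp: C_def) (metis Int_iff centre_in_ball empty_iff half_gt_zero)
    then have "\<not> negligible (ball p (r / 2) - V)"
      using assms(1) by (intro open_not_negligible) (auto simp: Diff_eq)
    then show ?thesis
      using meas[of p "r / 2"] by (simp add: negligible_iff_measure f_def zero_less_measure_iff)
  qed
  have "compact C" unfolding C_def by (intro compact_Int_closed) auto
  moreover have "C \<subseteq> (\<Union>p\<in>C. ball p (r / 2))" using \<open>0 < r\<close> by auto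
  ultimately obtain T where T: "T \<subseteq> C" "finite T" "C \<subseteq> (\<Union>p\<in>T. ball p (r / 2))"
    using compactE_image[of C C "\<lambda>p. ball p (r / 2)"] by (metis open_ball)
  define m where "m = Min (insert 1 (f ` T))"
  have "0 < m" unfolding m_def using T(1,2) f by (subst Min_gr_iff) auto
  moreover have "m \<le> measure lebesgue (ball q r - V)" if q: "q \<in> cball 0 R" "q \<notin> V" for q
  proof -
    have "q \<in> C" using q closure_subset[of "- V"] by (auto simp: C_def)
    then obtain p where p: "p \<in> T" "q \<in> ball p (r / 2)" using T(3) by blast
    have "m \<le> f p" unfolding m_def using p(1) T(2) by (intro Min_le) auto
    also have "ball p (r / 2) \<subseteq> ball q r"
    proof
      fix x assume "x \<in> ball p (r / 2)"
      then show "x \<in> ball q r" using p(2) dist_triangle[of q x p] by (auto simp: dist_commute)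
    qed
    then have "f p \<le> measure lebesgue (ball q r - V)"
      unfolding f_def using meas by (intro measure_mono_fmeasurable) (auto simp: fmeasurableD)
    finally show ?thesis .
  qed
  ultimately show ?thesis by blast
qed

section \<open>Limits of sequences with halving step sizes\<close>

lemma geometric_sum_dist:
  fixes a :: "nat \<Rightarrow> 'a::metric_space"
  assumes "\<And>m. \<mu> (Suc m) \<le> \<mu> m / 2" and "\<And>m. n \<le> m \<Longrightarrow> dist (a (Suc m)) (a m) \<le> \<mu> m" and "n \<le> m"
  shows "dist (a m) (a n) \<le> 2 * \<mu> n - 2 * \<mu> m"
  using \<open>n \<le> m\<close>
proof (induction m rule: dec_induct)
  \<comment> \<open>The summand \<open>- 2 * \<mu> m\<close> makes the induction close: the step
    costs \<open>\<mu> m\<close>, which is at most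
    \<open>2 * \<mu> m - 2 * \<mu> (Suc m)\<close>.\<close>
  case (step m)
  then show ?case
    using assms(1)[of m] assms(2)[of m] dist_triangle[of "a (Suc m)" "a n" "a m"] by simp
qed simp

lemma halving_tendsto_0:
  fixes \<mu> :: "nat \<Rightarrow> real"
  assumes "\<And>m. 0 < \<mu> m" "\<And>m. \<mu> (Suc m) \<le> \<mu> m / 2"
  shows "\<mu> \<longlonglongrightarrow> 0"
proof (rule tendsto_sandwich[of "\<lambda>_. 0" _ _ "\<lambda>m. \<mu> 0 * (1 / 2) ^ m"])
  have "\<mu> m \<le> \<mu> 0 * (1 / 2) ^ m" for m
  proof (induction m)
    case (Suc m)
    then show ?case using assms(2)[of m] by simp
  qed simp
  then show "\<forall>\<^sub>F m in sequentially. \<mu> m \<le> \<mu> 0 * (1 / 2) ^ m" by simp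
  show "(\<lambda>m. \<mu> 0 * (1 / 2) ^ m) \<longlonglongrightarrow> 0"
    by (intro tendsto_mult_right_zero LIMSEQ_power_zero) simp
  show "\<forall>\<^sub>F m in sequentially. 0 \<le> \<mu> m"
    by (intro always_eventually allI less_imp_le assms(1))
qed auto

lemma dist_lim_le:
  fixes a :: "nat \<Rightarrow> 'a::complete_space"
  assumes \<mu>: "\<And>m. 0 < \<mu> m" "\<And>m. \<mu> (Suc m) \<le> \<mu> m / 2"
    and a: "\<And>m. n \<le> m \<Longrightarrow> dist (a (Suc m)) (a m) \<le> \<mu> m"
  shows "a \<longlonglongrightarrow> lim a" "dist (a n) (lim a) \<le> 2 * \<mu> n"
proof -
  have near: "dist (a m) (a k) \<le> 2 * \<mu> k" if "n \<le> k" "k \<le> m" for m k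
  proof -
    have "dist (a m) (a k) \<le> 2 * \<mu> k - 2 * \<mu> m"
      by (rule geometric_sum_dist) (use \<mu>(2) a that in auto)
    then show ?thesis using \<mu>(1)[of m] by linarith
  qed
  have "Cauchy a"
    unfolding Cauchy_altdef2
  proof (intro allI impI)
    fix e :: real assume "0 < e"
    then have "\<forall>\<^sub>F m in sequentially. \<mu> m < e / 2"
      using halving_tendsto_0[of \<mu>] \<mu> by (intro order_tendstoD(2)[of _ 0]) auto
    then obtain k where k: "n \<le> k" "\<mu> k < e / 2"
      unfolding eventually_sequentially by (meson max.cobounded1 max.cobounded2)
    then have "\<forall>m\<ge>k. dist (a m) (a k) < e" using near by fastforce
    then show "\<exists>N. \<forall>m\<ge>N. dist (a m) (a N) < e" by blast
  qed
  then show lim: "a \<longlonglongrightarrow> lim a"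
    by (simp add: Cauchy_convergent_iff convergent_LIMSEQ_iff)
  have "(\<lambda>m. dist (a m) (a n)) \<longlonglongrightarrow> dist (lim a) (a n)"
    by (intro tendsto_intros lim)
  then have "dist (lim a) (a n) \<le> 2 * \<mu> n"
    by (rule LIMSEQ_le_const2) (use near in blast)
  then show "dist (a n) (lim a) \<le> 2 * \<mu> n" by (simp add: dist_commute)
qed

text \<open>From some index on, a neighbourhood of a given point lies in all \<open>A m\<close>, so
  the bound \<open>2 * \<mu> m\<close> makes the convergence uniform there.\<close>

lemma holomorphic_map_on_exhaustion_limit:
  fixes f :: "nat \<Rightarrow> complex ^ 'k \<Rightarrow> complex ^ 'm"
  assumes hol: "\<And>n. holomorphic_map_on (f n) UNIV" and \<mu>: "\<mu> \<longlonglongrightarrow> 0"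
    and A: "\<And>n. A n \<subseteq> interior (A (Suc n))"
    and lim: "\<And>n z. z \<in> A n \<Longrightarrow> dist (f n z) (g z) \<le> 2 * \<mu> n"
  shows "open (\<Union>n. A n)" "holomorphic_map_on g (\<Union>n. A n)"
proof -
  have mono: "A n \<subseteq> A m" if "n \<le> m" for n m
    using A interior_subset by (intro lift_Suc_mono_le[OF _ that]) blast
  have "(\<Union>n. A n) = (\<Union>n. interior (A n))"
    using A interior_subset by blast
  then show open_A: "open (\<Union>n. A n)" by (metis open_UN open_interior)
  show "holomorphic_map_on g (\<Union>n. A n)"
  proof (rule holomorphic_map_on_uniform_limit[OF open_A])
    show "holomorphic_map_on (f n) (\<Union>n. A n)" for n
      using hol by (rule holomorphic_map_on_subset) simp
    fix z assume "z \<in> (\<Union>n. A n)"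
    then obtain n where "z \<in> interior (A n)" using A by blast
    then obtain \<delta> where \<delta>: "\<delta> > 0" "ball z \<delta> \<subseteq> A n" unfolding mem_interior by blast
    have "uniform_limit (ball z \<delta>) f g sequentially"
      unfolding uniform_limit_iff
    proof (intro allI impI)
      fix e :: real assume "0 < e"
      then have "\<forall>\<^sub>F m in sequentially. \<mu> m < e / 2"
        using \<mu> by (intro order_tendstoD(2)[of _ 0]) auto
      then show "\<forall>\<^sub>F m in sequentially. \<forall>x\<in>ball z \<delta>. dist (f m x) (g x) < e"
        using eventually_ge_at_top[of n]
      proof eventually_elim
        case (elim m)
        then show ?case using lim[of _ m] mono[of n m] \<delta>(2) by fastforce
      qed
    qed
    then show "\<exists>\<delta>>0. uniform_limit (ball z \<delta>) f g sequentially" using \<delta>(1) by blast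
  qed
qed

text \<open>An enumeration of the nonempty members of a countable basis; a set that meets every
  \<open>N n\<close> is dense.\<close>

lemma countable_sequence_of_open_sets:
  obtains N :: "nat \<Rightarrow> 'a::second_countable_topology set"
  where "\<And>n. N n \<noteq> {}" "\<And>U. open U \<Longrightarrow> U \<noteq> {} \<Longrightarrow> \<exists>n. N n \<subseteq> U"
proof -
  obtain \<B> :: "'a set set" where \<B>: "countable \<B>" "topological_basis \<B>"
    using ex_countable_basis by blast
  have ex: "\<exists>B\<in>\<B> - {{}}. B \<subseteq> U" if U: "open U" "U \<noteq> {}" for U
  proof -
    obtain x where "x \<in> U" using U(2) by blast
    then show ?thesis using topological_basisE[OF \<B>(2) U(1)] by blast
  qed
  have "\<B> - {{}} \<noteq> {}" using ex[of UNIV] by blast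
  then have "range (from_nat_into (\<B> - {{}})) = \<B> - {{}}"
    using \<B>(1) by (intro range_from_nat_into) auto
  then show ?thesis using ex by (intro that[of "from_nat_into (\<B> - {{}})"]) (blast, metis rangeE)
qed

text \<open>Dependent choice produces the pairs \<open>(F n, \<mu> n)\<close>. The limit
  \<open>\<Psi>\<close> of the maps \<open>F n\<close> serves as the inverse of
  \<open>\<Phi>\<close>; density and measure are read off the sets \<open>V n\<close>, which
  increase to the image.\<close>

lemma biholomorphism_onto_dense_set:
  fixes G :: "nat \<Rightarrow> complex ^ 'k \<Rightarrow> complex ^ 'k"
  assumes card: "2 \<le> CARD('k)" and G: "\<And>n. automorphism (G n)"
    and nest: "\<And>n. G n -` polydisc 2 \<subseteq> interior (G (Suc n) -` polydisc 1)"
  shows "\<exists>\<Phi>. biholomorphism \<Phi> (\<Union>n. G n -` polydisc 1) (\<Phi> ` (\<Union>n. G n -` polydisc 1)) \<and>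
    closure (\<Phi> ` (\<Union>n. G n -` polydisc 1)) = UNIV \<and>
    (\<forall>p \<epsilon>. p \<notin> \<Phi> ` (\<Union>n. G n -` polydisc 1) \<longrightarrow> 0 < \<epsilon> \<longrightarrow>
      0 < measure lebesgue (ball p \<epsilon> - \<Phi> ` (\<Union>n. G n -` polydisc 1)))"
proof -
  define K where "K n = G n -` polydisc 1" for n
  have compact_K: "compact (K n)" for n
    unfolding K_def by (rule compact_vimage_automorphism[OF G compact_polydisc])
  have G2: "G n -` polydisc 2 \<subseteq> K (Suc n)" for n
    using nest[of n] interior_subset unfolding K_def by blast
  have K_int: "K n \<subseteq> interior (K (Suc n))" for n
    using nest[of n] polydisc_mono[of 1 2] unfolding K_def by auto
  have K_mono: "K n \<subseteq> K m" if "n \<le> m" for n m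
    using K_int interior_subset by (intro lift_Suc_mono_le[OF _ that]) blast
  obtain N :: "nat \<Rightarrow> (complex ^ 'k) set" where N: "\<And>n. N n \<noteq> {}"
      "\<And>U. open U \<Longrightarrow> U \<noteq> {} \<Longrightarrow> \<exists>n. N n \<subseteq> U"
    using countable_sequence_of_open_sets by blast

  \<comment> \<open>The tolerances at least halve in each step, so all later changes add up to at most \<open>2 * \<mu>\<close>;
    the factor \<open>4\<close> leaves room for them.\<close>
  define P where "P n p \<longleftrightarrow> (case p of (F, \<mu>) \<Rightarrow> automorphism F \<and> (0::real) < \<mu> \<and>
      (\<forall>z\<in>K n. cball z (4 * \<mu>) \<subseteq> K (Suc n)) \<and>
      (\<forall>p\<in>cball 0 (real n + 1). p \<notin> F -` K n \<longrightarrow>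
        4 * \<mu> \<le> measure lebesgue (ball p (1 / (real n + 1)) - F -` K n)))" for n p
  define Q where "Q n p p' \<longleftrightarrow> (case p of (F, \<mu>) \<Rightarrow> case p' of (F', \<mu>') \<Rightarrow>
      (\<forall>z\<in>K n. norm (F' (inv F z) - z) \<le> \<mu> \<and> norm (F (inv F' z) - z) \<le> \<mu> \<and>
        norm (inv F' z - inv F z) \<le> \<mu>) \<and>
      measure lebesgue {x\<in>cball 0 (real n + 2). F x \<notin> K n \<and> F' x \<in> K (Suc n)} \<le> \<mu> \<and>
      (\<exists>x\<in>N n. F x \<in> K n \<or> F' x \<in> K (Suc n)) \<and> \<mu>' \<le> \<mu> / 2)" for n p p'
  \<comment> \<open>The tolerance is chosen when \<open>F\<close> is already known, so it may depend
    on the measure left outside the preimage of \<open>K n\<close>.\<close>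
  have ex_P: "\<exists>\<mu>. P n (F, \<mu>) \<and> \<mu> \<le> u" if F: "automorphism F" and "0 < u" for n F u
  proof -
    obtain d where d: "0 < d" "(\<Union>z\<in>K n. cball z d) \<subseteq> interior (K (Suc n))"
      using compact_subset_open_imp_cball_epsilon_subset[OF compact_K open_interior K_int] by blast
    have "closed (F -` K n)"
      using compact_vimage_automorphism[OF F compact_K] by (rule compact_imp_closed)
    then obtain m where m: "m > 0" "\<forall>p\<in>cball 0 (real n + 1). p \<notin> F -` K n \<longrightarrow>
        m \<le> measure lebesgue (ball p (1 / (real n + 1)) - F -` K n)"
      using measure_ball_diff_lower_bound[of "F -` K n" "1 / (real n + 1)" "real n + 1"] by auto
    define \<mu> where "\<mu> = min u (min (d / 4) (m / 4))"
    have \<mu>: "0 < \<mu>" "\<mu> \<le> u" "4 * \<mu> \<le> d" "4 * \<mu> \<le> m"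
      using d(1) m(1) \<open>0 < u\<close> by (auto simp: \<mu>_def min_def)
    have "cball z (4 * \<mu>) \<subseteq> K (Suc n)" if "z \<in> K n" for z
    proof -
      have "cball z (4 * \<mu>) \<subseteq> cball z d" using \<mu>(3) by (rule subset_cball)
      also have "\<dots> \<subseteq> interior (K (Suc n))" using d(2) that by blast
      finally show ?thesis using interior_subset by blast
    qed
    moreover have "\<forall>p\<in>cball 0 (real n + 1). p \<notin> F -` K n \<longrightarrow>
        4 * \<mu> \<le> measure lebesgue (ball p (1 / (real n + 1)) - F -` K n)"
      using m(2) \<mu>(4) by (meson order_trans)
    ultimately have "P n (F, \<mu>)" unfolding P_def using F \<mu>(1) by simp
    then show ?thesis using \<mu>(2) by blast
  qed
  have "\<exists>f. \<forall>n. P n (f n) \<and> Q n (f n) (f (Suc n))"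
  proof (rule dependent_nat_choice)
    show "\<exists>p. P 0 p" using ex_P[OF automorphism_id, of 1 0] by auto
    fix p n assume "P n p"
    obtain F \<mu> where p: "p = (F, \<mu>)" by (cases p)
    have F: "automorphism F" "0 < \<mu>" using \<open>P n p\<close> by (auto simp: P_def p)
    obtain F' where F': "automorphism F'"
        "\<forall>z\<in>K n. norm (F' (inv F z) - z) \<le> \<mu> \<and> norm (F (inv F' z) - z) \<le> \<mu> \<and>
          norm (inv F' z - inv F z) \<le> \<mu>"
        "measure lebesgue {x\<in>cball 0 (real n + 2). F x \<notin> K n \<and> F' x \<in> K (Suc n)} \<le> \<mu>"
        "\<exists>x\<in>N n. F x \<in> K n \<or> F' x \<in> K (Suc n)"
      using automorphism_modification_step[OF card F(1) G K_def compact_K G2 N(1) F(2)] by blast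
    obtain \<mu>' where "P (Suc n) (F', \<mu>')" "\<mu>' \<le> \<mu> / 2"
      using ex_P[OF F'(1), of "\<mu> / 2" "Suc n"] F(2) by auto
    then show "\<exists>p'. P (Suc n) p' \<and> Q n p p'"
      using F' by (intro exI[of _ "(F', \<mu>')"]) (simp add: Q_def p)
  qed
  then obtain f where f: "\<And>n. P n (f n)" "\<And>n. Q n (f n) (f (Suc n))" by blast
  define F where "F n = fst (f n)" for n
  define \<mu> where "\<mu> n = snd (f n)" for n
  have f_eq: "f n = (F n, \<mu> n)" for n by (simp add: F_def \<mu>_def)
  note P = f(1)[unfolded f_eq P_def, simplified]
  note Q = f(2)[unfolded f_eq Q_def, simplified]
  have F: "automorphism (F n)" and \<mu>_pos: "0 < \<mu> n"
    and cball_K: "\<And>z. z \<in> K n \<Longrightarrow> cball z (4 * \<mu> n) \<subseteq> K (Suc n)" for n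
    using P[of n] by auto
  have lower: "4 * \<mu> n \<le> measure lebesgue (ball p (1 / (real n + 1)) - F n -` K n)"
    if "norm p \<le> real n + 1" "p \<notin> F n -` K n" for n p
    using P[of n] that by auto
  have \<mu>_half: "\<mu> (Suc n) \<le> \<mu> n / 2"
    and new: "measure lebesgue {x\<in>cball 0 (real n + 2). F n x \<notin> K n \<and> F (Suc n) x \<in> K (Suc n)} \<le> \<mu> n"
    and meets: "\<exists>x\<in>N n. F n x \<in> K n \<or> F (Suc n) x \<in> K (Suc n)" for n
    using Q[of n] by auto
  have near: "dist (F (Suc n) (inv (F n) z)) z \<le> \<mu> n" "dist (F n (inv (F (Suc n)) z)) z \<le> \<mu> n"
    "dist (inv (F (Suc n)) z) (inv (F n) z) \<le> \<mu> n" if "z \<in> K n" for n z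
    using Q[of n] that by (auto simp: dist_norm)
  have \<mu>_anti: "\<mu> m \<le> \<mu> n" if "n \<le> m" for n m
  proof (rule lift_Suc_antimono_le[OF _ that])
    show "\<mu> (Suc n) \<le> \<mu> n" for n using \<mu>_half[of n] \<mu>_pos[of n] by linarith
  qed
  have \<mu>_lim: "\<mu> \<longlonglongrightarrow> 0" using \<mu>_pos \<mu>_half by (rule halving_tendsto_0)

  define V where "V n = F n -` K n" for n
  have F_step: "dist (F (Suc n) x) (F n x) \<le> \<mu> n" if "x \<in> V n" for n x
    using near(1)[of "F n x" n] that F[of n] by (simp add: V_def)
  have V_int: "V n \<subseteq> interior (V (Suc n))" for n
  proof
    fix x assume x: "x \<in> V n"
    \<comment> \<open>\<open>F (Suc n) x\<close> is within \<open>\<mu> n\<close> of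
      \<open>F n x\<close>, and the ball of radius \<open>4 * \<mu> n\<close> about the latter lies
      in \<open>K (Suc n)\<close>.\<close>
    show "x \<in> interior (V (Suc n))"
    proof (rule interiorI)
      show "open (F (Suc n) -` ball (F n x) (4 * \<mu> n))"
        by (rule open_vimage_automorphism[OF F open_ball])
      show "x \<in> F (Suc n) -` ball (F n x) (4 * \<mu> n)"
        using F_step[OF x] \<mu>_pos[of n] by (simp add: dist_commute)
      show "F (Suc n) -` ball (F n x) (4 * \<mu> n) \<subseteq> V (Suc n)"
        using cball_K[of "F n x" n] x ball_subset_cball unfolding V_def by blast
    qed
  qed
  have V_mono: "V n \<subseteq> V m" if "n \<le> m" for n m
    using V_int interior_subset by (intro lift_Suc_mono_le[OF _ that]) blast
  define \<Omega> where "\<Omega> = (\<Union>n. K n)"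
  define \<Omega>' where "\<Omega>' = (\<Union>n. V n)"
  define \<Phi> where "\<Phi> z = lim (\<lambda>n. inv (F n) z)" for z
  define \<Psi> where "\<Psi> x = lim (\<lambda>n. F n x)" for x
  have \<Phi>: "(\<lambda>m. inv (F m) z) \<longlonglongrightarrow> \<Phi> z" "dist (inv (F n) z) (\<Phi> z) \<le> 2 * \<mu> n" if "z \<in> K n" for n z
    unfolding \<Phi>_def
    by (rule dist_lim_le[where a = "\<lambda>m. inv (F m) z", OF \<mu>_pos \<mu>_half near(3)];
        use that K_mono in blast)+
  have \<Psi>: "(\<lambda>m. F m x) \<longlonglongrightarrow> \<Psi> x" "dist (F n x) (\<Psi> x) \<le> 2 * \<mu> n" if "x \<in> V n" for n x
    unfolding \<Psi>_def
    by (rule dist_lim_le[where a = "\<lambda>m. F m x", OF \<mu>_pos \<mu>_half F_step];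
        use that V_mono in blast)+
  have open_\<Omega>: "open \<Omega>" and hol_\<Phi>: "holomorphic_map_on \<Phi> \<Omega>"
    unfolding \<Omega>_def
    using holomorphic_map_on_exhaustion_limit[of "\<lambda>n. inv (F n)" \<mu> K \<Phi>, OF automorphism_inv_holomorphic[OF F] \<mu>_lim K_int \<Phi>(2)]
    by auto
  have open_\<Omega>': "open \<Omega>'" and hol_\<Psi>: "holomorphic_map_on \<Psi> \<Omega>'"
    unfolding \<Omega>'_def
    using holomorphic_map_on_exhaustion_limit[of F \<mu> V \<Psi>, OF automorphism_holomorphic[OF F] \<mu>_lim V_int \<Psi>(2)]
    by auto

  have \<Psi>_in: "\<Psi> x \<in> \<Omega>" if hyp: "x \<in> \<Omega>'" for x
  proof -
    obtain n where n: "x \<in> V n" using hyp by (auto simp: \<Omega>'_def)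
    have "\<Psi> x \<in> cball (F n x) (4 * \<mu> n)" using \<Psi>(2)[OF n] \<mu>_pos[of n] by simp
    then show ?thesis using cball_K[of "F n x" n] n by (auto simp: \<Omega>_def V_def)
  qed
  have \<Phi>_in: "\<Phi> z \<in> \<Omega>'" if hyp: "z \<in> \<Omega>" for z
  proof -
    obtain j where j: "z \<in> K j" using hyp by (auto simp: \<Omega>_def)
    \<comment> \<open>Downward induction: \<open>F i \<circ> inv (F m)\<close> undoes the steps from \<open>m\<close> back to \<open>i\<close>, each of which is
      close to the identity on \<open>K (Suc j)\<close>.\<close>
    have "F (Suc j) (inv (F m) z) \<in> K (Suc j)" if m: "Suc j \<le> m" for m
    proof -
      have in_K: "w \<in> K (Suc j)" if "dist w z \<le> 2 * \<mu> (Suc i)" "Suc j \<le> Suc i" for w i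
      proof -
        \<comment> \<open>Here \<open>2 * \<mu> (Suc i) \<le> \<mu> i \<le> \<mu> j\<close>, as
          \<open>j \<le> i\<close>.\<close>
        have "dist z w \<le> 4 * \<mu> j"
          using that \<mu>_half[of i] \<mu>_anti[of j i] \<mu>_pos[of j] by (simp add: dist_commute)
        then show ?thesis using cball_K[OF j] by auto
      qed
      have "dist (F i (inv (F m) z)) z \<le> 2 * \<mu> i" if "i \<le> m" "Suc j \<le> i" for i
        using that
      proof (induction i rule: inc_induct)
        case base
        then show ?case using F \<mu>_pos[of m] by simp
      next
        case (step i)
        let ?w = "F (Suc i) (inv (F m) z)"
        have IH: "dist ?w z \<le> 2 * \<mu> (Suc i)" using step by simp
        then have "?w \<in> K (Suc j)" using in_K step by simp
        then have "?w \<in> K i" using K_mono[of "Suc j" i] step.prems by auto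
        then have "dist (F i (inv (F m) z)) ?w \<le> \<mu> i" using near(2)[of ?w i] F by simp
        then show ?case
          using IH \<mu>_half[of i] dist_triangle[of "F i (inv (F m) z)" z ?w] by linarith
      qed
      then have "dist (F (Suc j) (inv (F m) z)) z \<le> 2 * \<mu> (Suc j)" using m by simp
      then show ?thesis using in_K by blast
    qed
    then have ev: "\<forall>\<^sub>F m in sequentially. F (Suc j) (inv (F m) z) \<in> K (Suc j)"
      unfolding eventually_sequentially by blast
    have "isCont (F (Suc j)) (\<Phi> z)"
      using automorphism_continuous_on[OF F, of UNIV] by (simp add: continuous_on_eq_continuous_at)
    then have lim: "(\<lambda>m. F (Suc j) (inv (F m) z)) \<longlonglongrightarrow> F (Suc j) (\<Phi> z)"
      using \<Phi>(1)[OF j] by (rule isCont_tendsto_compose)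
    \<comment> \<open>The limit stays in \<open>K (Suc j)\<close> since that set is closed, so
      \<open>\<Phi> z\<close> lies in \<open>V (Suc j)\<close>.\<close>
    have "F (Suc j) (\<Phi> z) \<in> K (Suc j)"
      by (rule Lim_in_closed_set[OF compact_imp_closed[OF compact_K] ev sequentially_bot lim])
    then show ?thesis by (auto simp: \<Omega>'_def V_def)
  qed
  have cont: "isCont g x" if "holomorphic_map_on g U" "open U" "x \<in> U" for g x and U :: "(complex ^ 'k) set"
    using holomorphic_map_on_imp_continuous_on[OF that(1)] that(2,3) by (simp add: continuous_on_eq_continuous_at)
  have \<Psi>_\<Phi>: "\<Psi> (\<Phi> z) = z" if hyp: "z \<in> \<Omega>" for z
  proof -
    obtain n where n: "z \<in> K n" using hyp by (auto simp: \<Omega>_def)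
    \<comment> \<open>\<open>F m\<close> maps \<open>inv (F m) z\<close> back to \<open>z\<close>,
      and on \<open>V m\<close> it differs from \<open>\<Psi>\<close> by at most
      \<open>2 * \<mu> m\<close>.\<close>
    have "\<forall>\<^sub>F m in sequentially. dist (\<Psi> (inv (F m) z)) z \<le> 2 * \<mu> m"
      using eventually_ge_at_top[of n]
    proof eventually_elim
      case (elim m)
      then have "inv (F m) z \<in> V m" using K_mono[of n m] n F by (auto simp: V_def)
      from \<Psi>(2)[OF this] show ?case using F by (simp add: dist_commute)
    qed
    then have "(\<lambda>m. dist (\<Psi> (inv (F m) z)) z) \<longlonglongrightarrow> 0"
      by (intro Lim_null_comparison[OF _ tendsto_mult_right_zero[OF \<mu>_lim, of 2]]) simp
    then have "(\<lambda>m. \<Psi> (inv (F m) z)) \<longlonglongrightarrow> z" by (rule tendsto_dist_iff[THEN iffD2])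
    moreover have "(\<lambda>m. \<Psi> (inv (F m) z)) \<longlonglongrightarrow> \<Psi> (\<Phi> z)"
      using cont[OF hol_\<Psi> open_\<Omega>' \<Phi>_in[OF hyp]] \<Phi>(1)[OF n] by (rule isCont_tendsto_compose)
    ultimately show ?thesis using LIMSEQ_unique by blast
  qed
  have \<Phi>_\<Psi>: "\<Phi> (\<Psi> x) = x" if hyp: "x \<in> \<Omega>'" for x
  proof -
    obtain n where n: "x \<in> V n" using hyp by (auto simp: \<Omega>'_def)
    have "\<forall>\<^sub>F m in sequentially. dist (\<Phi> (F m x)) x \<le> 2 * \<mu> m"
      using eventually_ge_at_top[of n]
    proof eventually_elim
      case (elim m)
      then have "F m x \<in> K m" using V_mono[of n m] n by (auto simp: V_def)
      from \<Phi>(2)[OF this] show ?case using F by (simp add: dist_commute)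
    qed
    then have "(\<lambda>m. dist (\<Phi> (F m x)) x) \<longlonglongrightarrow> 0"
      by (intro Lim_null_comparison[OF _ tendsto_mult_right_zero[OF \<mu>_lim, of 2]]) simp
    then have "(\<lambda>m. \<Phi> (F m x)) \<longlonglongrightarrow> x" by (rule tendsto_dist_iff[THEN iffD2])
    moreover have "(\<lambda>m. \<Phi> (F m x)) \<longlonglongrightarrow> \<Phi> (\<Psi> x)"
      using cont[OF hol_\<Phi> open_\<Omega> \<Psi>_in[OF hyp]] \<Psi>(1)[OF n] by (rule isCont_tendsto_compose)
    ultimately show ?thesis using LIMSEQ_unique by blast
  qed
  have image: "\<Phi> ` \<Omega> = \<Omega>'"
    using \<Phi>_in \<Psi>_in \<Phi>_\<Psi> by (metis image_eqI subsetI subset_antisym image_subsetI)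
  have inj: "inj_on \<Phi> \<Omega>" using \<Psi>_\<Phi> by (rule inj_on_inverseI)
  have inv: "inv_into \<Omega> \<Phi> x = \<Psi> x" if "x \<in> \<Omega>'" for x
    using inv_into_f_f[OF inj \<Psi>_in[OF that]] \<Phi>_\<Psi>[OF that] by simp
  \<comment> \<open>Agreement with \<open>\<Psi>\<close> on \<open>\<Omega>'\<close> suffices
    because the derivatives are taken within that set.\<close>
  have "holomorphic_map_on (inv_into \<Omega> \<Phi>) \<Omega>'"
    using hol_\<Psi> unfolding holomorphic_map_on_def
    by (meson has_derivative_transform inv)
  then have biholo: "biholomorphism \<Phi> \<Omega> (\<Phi> ` \<Omega>)"
    unfolding biholomorphism_def image using open_\<Omega> open_\<Omega>' hol_\<Phi> inj image by (simp add: bij_betw_def)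

  have dense: "closure \<Omega>' = UNIV"
  proof (rule ccontr)
    assume "closure \<Omega>' \<noteq> UNIV"
    then obtain n where n: "N n \<subseteq> - closure \<Omega>'" using N(2)[of "- closure \<Omega>'"] by auto
    obtain x where "x \<in> N n" "x \<in> V n \<or> x \<in> V (Suc n)" using meets[of n] by (auto simp: V_def)
    then have "x \<in> \<Omega>'" by (auto simp: \<Omega>'_def)
    then show False using \<open>x \<in> N n\<close> n closure_subset by blast
  qed
  have "0 < measure lebesgue (ball p \<epsilon> - \<Omega>')" if p: "p \<notin> \<Omega>'" and "0 < \<epsilon>" for p \<epsilon>
  proof -
    \<comment> \<open>This \<open>n\<close> puts \<open>p\<close> into the region where the lower
      bound of step \<open>n\<close> holds and makes the radius \<open>1 / (n + 1)\<close> at most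
      \<open>\<epsilon>\<close>.\<close>
    obtain n :: nat where n: "norm p \<le> n" "1 / \<epsilon> \<le> n"
      by (metis max.bounded_iff real_arch_simple)
    have r: "1 / (real n + 1) \<le> \<epsilon>" using n(2) \<open>0 < \<epsilon>\<close> by (simp add: field_simps)
    define A where "A = ball p (1 / (real n + 1))"
    have A_sub: "A \<subseteq> cball 0 (real n + 2)"
    proof
      fix x assume "x \<in> A"
      then have "norm (x - p) < 1 / (real n + 1)" by (simp add: A_def dist_norm norm_minus_commute)
      also have "\<dots> \<le> 1" by simp
      finally have "norm (x - p) < 1" .
      then have "norm x \<le> real n + 2" using n(1) norm_triangle_sub[of x p] by linarith
      then show "x \<in> cball 0 (real n + 2)" by simp
    qed
    have V_compact: "compact (V m)" for m
      unfolding V_def by (intro compact_vimage_automorphism F compact_K)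
    then have V_closed: "closed (V m)" for m by (rule compact_imp_closed)
    have meas: "A - U \<in> lmeasurable" if "U \<in> sets borel" for U
      using that by (intro bounded_set_imp_lmeasurable)
        (auto simp: A_def intro: bounded_subset[OF bounded_ball])
    have AV: "A - V m \<in> lmeasurable" for m
      using V_closed by (intro meas borel_closed)
    have p_V: "p \<notin> V m" for m using p by (auto simp: \<Omega>'_def)
    \<comment> \<open>Step \<open>m\<close> takes away at most \<open>\<mu> m\<close>. Starting from
      \<open>4 * \<mu> n\<close>, the summand \<open>2 * \<mu> m\<close> is the reserve for all
      steps still to come, so at least \<open>2 * \<mu> n\<close> survives.\<close>
    have bound: "2 * \<mu> n + 2 * \<mu> m \<le> measure lebesgue (A - V m)" if "n \<le> m" for m
      using that
    proof (induction m rule: dec_induct)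
      case base
      then show ?case using lower[of p n] p_V[of n] n(1) by (simp add: A_def V_def)
    next
      case (step m)
      define E where "E = {x\<in>cball 0 (real m + 2). F m x \<notin> K m \<and> F (Suc m) x \<in> K (Suc m)}"
      have E_eq: "E = cball 0 (real m + 2) \<inter> V (Suc m) - V m" unfolding E_def V_def by blast
      have "compact (cball 0 (real m + 2) \<inter> V (Suc m))"
        by (intro compact_Int_closed compact_cball V_closed)
      then have E: "E \<in> lmeasurable"
        unfolding E_eq by (intro fmeasurable.Diff lmeasurable_compact V_compact)
      have "A \<subseteq> cball 0 (real m + 2)"
        using step.hyps by (intro order_trans[OF A_sub] subset_cball) simp
      then have "A - V m \<subseteq> (A - V (Suc m)) \<union> E" unfolding E_eq by blast
      then have "measure lebesgue (A - V m) \<le> measure lebesgue ((A - V (Suc m)) \<union> E)"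
        using AV E by (intro measure_mono_fmeasurable) (auto simp: fmeasurableD)
      also have "\<dots> \<le> measure lebesgue (A - V (Suc m)) + measure lebesgue E"
        using AV E by (intro measure_Un_le) (auto simp: fmeasurableD)
      finally show ?case using step.IH new[of m] \<mu>_half[of m] by (simp add: E_def)
    qed
    have "(\<lambda>m. measure lebesgue (A - V (m + n))) \<longlonglongrightarrow> measure lebesgue (\<Inter>m. A - V (m + n))"
    proof (rule Lim_measure_decseq)
      show "range (\<lambda>m. A - V (m + n)) \<subseteq> sets lebesgue" using AV by (auto simp: fmeasurableD)
      show "decseq (\<lambda>m. A - V (m + n))" 
        unfolding decseq_def by (intro allI impI Diff_mono order_refl V_mono) simp
      show "emeasure lebesgue (A - V (m + n)) \<noteq> \<infinity>" for m using fmeasurableD2[OF AV] by simp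
    qed
    moreover have "(\<Inter>m. A - V (m + n)) = A - \<Omega>'"
    proof -
      have "\<Omega>' = (\<Union>m. V (m + n))" unfolding \<Omega>'_def using V_mono[OF le_add1] by blast
      then show ?thesis by auto
    qed
    ultimately have lim: "(\<lambda>m. measure lebesgue (A - V (m + n))) \<longlonglongrightarrow> measure lebesgue (A - \<Omega>')"
      by simp
    have "2 * \<mu> n \<le> measure lebesgue (A - V (m + n))" for m
      using bound[of "m + n"] \<mu>_pos[of "m + n"] by simp
    then have "2 * \<mu> n \<le> measure lebesgue (A - \<Omega>')"
      by (intro LIMSEQ_le_const[OF lim]) auto
    also have "\<dots> \<le> measure lebesgue (ball p \<epsilon> - \<Omega>')"
    proof (rule measure_mono_fmeasurable)
      show "A - \<Omega>' \<subseteq> ball p \<epsilon> - \<Omega>'" using r by (auto simp: A_def)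
      show "A - \<Omega>' \<in> sets lebesgue" using open_\<Omega>' by (intro fmeasurableD[OF meas]) auto
      show "ball p \<epsilon> - \<Omega>' \<in> lmeasurable"
        using open_\<Omega>' by (intro bounded_set_imp_lmeasurable) (auto intro: bounded_subset[OF bounded_ball])
    qed
    finally show ?thesis using \<mu>_pos[of n] by linarith
  qed
  then show ?thesis
    using biholo dense unfolding image[symmetric] unfolding \<Omega>_def K_def by blast
qed

section \<open>Basins of attraction\<close>

lemma automorphism_scale:
  fixes c :: complex
  assumes "c \<noteq> 0"
  shows "automorphism ((*s) c :: complex ^ 'k \<Rightarrow> complex ^ 'k)"
proof (rule automorphismI(1))
  have "holomorphic_map_on ((*s) b :: complex ^ 'k \<Rightarrow> complex ^ 'k) UNIV" for b
    unfolding holomorphic_map_on_def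
    using bounded_linear_imp_has_derivative[OF bounded_bilinear.bounded_linear_right[OF bounded_bilinear_vector_smult, of b]]
    by (intro ballI exI[of _ "(*s) b"]) (auto simp: linear_smult_iff vector_add_ldistrib vector_smult_assoc mult.commute)
  then show "holomorphic_map_on ((*s) c :: complex ^ 'k \<Rightarrow> complex ^ 'k) UNIV"
    "holomorphic_map_on ((*s) (inverse c) :: complex ^ 'k \<Rightarrow> complex ^ 'k) UNIV" by auto
qed (use assms in \<open>auto simp: vector_smult_assoc\<close>)

lemma automorphism_comp_upto:
  assumes "\<And>n. automorphism (S n)"
  shows "automorphism (comp_upto S n)"
proof (induction n)
  case (Suc n)
  show ?case unfolding comp_upto.simps by (rule automorphism_compose[OF Suc assms])
qed (simp add: assms)

text \<open>Once the orbit is inside the ball it stays there, because \<open>C \<le> 1\<close>, and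
  each further step gains a factor \<open>C\<close>.\<close>

lemma norm_comp_upto_le:
  assumes "0 \<le> C" "C \<le> 1" and S: "\<And>n z. z \<in> ball 0 r \<Longrightarrow> norm (S n z) \<le> C * norm z"
    and "norm (comp_upto S n z) < r"
  shows "norm (comp_upto S (n + j) z) \<le> C ^ j * norm (comp_upto S n z)"
proof (induction j)
  case (Suc j)
  have "C ^ j * norm (comp_upto S n z) \<le> 1 * norm (comp_upto S n z)"
    using assms(1,2) by (intro mult_right_mono power_le_one) auto
  then have "comp_upto S (n + j) z \<in> ball 0 r" using Suc assms(4) by simp
  then have "norm (comp_upto S (n + Suc j) z) \<le> C * norm (comp_upto S (n + j) z)"
    using S by simp
  also have "\<dots> \<le> C * (C ^ j * norm (comp_upto S n z))"
    using Suc assms(1) by (intro mult_left_mono) auto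
  finally show ?case by (simp add: mult.assoc)
qed simp

lemma ball_subset_polydisc: "ball 0 s \<subseteq> polydisc s"
proof
  fix z :: "complex ^ 'k" assume "z \<in> ball 0 s"
  then show "z \<in> polydisc s"
    unfolding polydisc_def using Finite_Cartesian_Product.norm_nth_le[of z] by (auto intro: order_trans less_imp_le)
qed

text \<open>A point belongs to the basin exactly when its orbit enters the ball of radius
  \<open>r\<close> at some time, since it is contracted from then on. \<open>G n\<close> is the
  composition up to index \<open>n * Suc q\<close>, rescaled by \<open>1 / s\<close>; blocks of
  \<open>Suc q\<close> maps contract strongly enough for the nesting.\<close>

lemma basin_eq_exhaustion:
  fixes S :: "nat \<Rightarrow> complex ^ 'k \<Rightarrow> complex ^ 'k"
  assumes S: "\<And>n. automorphism (S n)" and "uniform_upper_bound S"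
  obtains G where "\<And>n. automorphism (G n)" "\<And>n. G n -` polydisc 2 \<subseteq> interior (G (Suc n) -` polydisc 1)"
    "basin S = (\<Union>n. G n -` polydisc 1)"
proof -
  obtain r C where r: "r > 0" and C: "0 < C" "C < 1"
    and contr: "\<And>n z. z \<in> ball 0 r \<Longrightarrow> norm (S n z) \<le> C * norm z"
    using assms(2) unfolding uniform_upper_bound_def by blast
  \<comment> \<open>Makes the polydisc of radius \<open>2 * s\<close> lie inside the ball of radius
    \<open>r\<close>.\<close>
  define s where "s = r / (2 * real CARD('k) + 1)"
  have s: "0 < s" using r by (simp add: s_def add_pos_pos)
  have s_r: "real CARD('k) * (2 * s) < r" using r by (simp add: s_def field_simps)
  \<comment> \<open>One block then contracts the ball of radius \<open>r\<close> into the ball of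
    radius \<open>s\<close>.\<close>
  obtain q where q: "C ^ q * r < s"
    using real_arch_pow_inv[of "s / r" C] C r s by (auto simp: field_simps)
  define T where "T n = comp_upto S (n * Suc q)" for n
  define G where "G n = (*s) (inverse (of_real s)) \<circ> T n" for n
  have auto_G: "automorphism (G n)" for n
    unfolding G_def T_def using s
    by (intro automorphism_compose automorphism_comp_upto S automorphism_scale) auto
  have norm_G: "norm (G n z) = norm (T n z) / s" for n z
    using s by (simp add: G_def norm_vector_smult norm_inverse norm_divide field_simps)
  have small: "norm (T n z) < r" if "G n z \<in> polydisc a" "a \<le> 2" for n z a
  proof -
    have "norm (G n z) \<le> real CARD('k) * 2"
      using norm_le_polydisc[OF that(1)] that(2) by (meson mult_left_mono of_nat_0_le_iff order_trans)
    then have "norm (T n z) \<le> real CARD('k) * (2 * s)" using s by (simp add: norm_G field_simps)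
    then show ?thesis using s_r by simp
  qed
  have decay: "norm (comp_upto S (n * Suc q + j) z) \<le> C ^ j * norm (T n z)" if "norm (T n z) < r" for n z j
    using that C unfolding T_def by (intro norm_comp_upto_le[of C r S] contr) auto
  have "G n -` polydisc 2 \<subseteq> G (Suc n) -` ball 0 1" for n
  proof
    fix z assume "z \<in> G n -` polydisc 2"
    then have less: "norm (T n z) < r" using small by simp
    have "Suc n * Suc q = n * Suc q + Suc q" by simp
    then have "T (Suc n) z = comp_upto S (n * Suc q + Suc q) z" unfolding T_def by (simp only:)
    then have "norm (T (Suc n) z) \<le> C ^ Suc q * norm (T n z)" using decay[OF less] by metis
    also have "\<dots> \<le> C ^ q * r"
      using less C r by (intro mult_mono power_decreasing) auto
    finally show "z \<in> G (Suc n) -` ball 0 1" using q s by (simp add: norm_G)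
  qed
  moreover have "G n -` ball 0 1 \<subseteq> interior (G n -` polydisc 1)" for n
    using ball_subset_polydisc by (intro interior_maximal open_vimage_automorphism auto_G) auto
  ultimately have nest: "G n -` polydisc 2 \<subseteq> interior (G (Suc n) -` polydisc 1)" for n
    by blast
  have "basin S = (\<Union>n. G n -` polydisc 1)"
  proof (rule set_eqI, rule iffI)
    fix z assume "z \<in> basin S"
    then have "(\<lambda>n. norm (comp_upto S n z)) \<longlonglongrightarrow> 0"
      by (simp add: basin_def tendsto_norm_zero)
    then have "\<forall>\<^sub>F n in sequentially. norm (comp_upto S n z) < s"
      using s by (rule order_tendstoD)
    \<comment> \<open>Smallness is known for large indices only, and \<open>n * Suc q\<close> is at
      least \<open>n\<close>.\<close>
    then obtain n where "norm (comp_upto S (n * Suc q) z) < s"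
      unfolding eventually_sequentially by (metis le_add1 mult_Suc_right)
    then have "G n z \<in> ball 0 1" using s norm_G[of n z] by (simp add: T_def)
    then show "z \<in> (\<Union>n. G n -` polydisc 1)" using ball_subset_polydisc by blast
  next
    fix z assume "z \<in> (\<Union>n. G n -` polydisc 1)"
    then obtain n where "G n z \<in> polydisc 1" by auto
    then have less: "norm (T n z) < r" using small[of n z 1] by simp
    have lim: "(\<lambda>j. C ^ j * norm (T n z)) \<longlonglongrightarrow> 0"
      using C by (intro tendsto_mult_left_zero LIMSEQ_power_zero) auto
    have "\<forall>\<^sub>F j in sequentially. norm (comp_upto S (n * Suc q + j) z) \<le> C ^ j * norm (T n z)"
      by (intro always_eventually allI decay less)
    then have "(\<lambda>j. comp_upto S (n * Suc q + j) z) \<longlonglongrightarrow> 0"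
      using lim by (rule Lim_null_comparison)
    then have "(\<lambda>j. comp_upto S (j + n * Suc q) z) \<longlonglongrightarrow> 0" by (simp only: add.commute)
    then have "(\<lambda>m. comp_upto S m z) \<longlonglongrightarrow> 0" by (rule LIMSEQ_offset)
    then show "z \<in> basin S" by (simp add: basin_def)
  qed
  then show ?thesis using that[of G] auto_G nest by blast
qed

text \<open>An open dense set has its complement as frontier, and by \<open>pos\<close> this
  complement has positive volume in every ball about one of its points.\<close>

lemma full_hausdorff_dim_at_frontier:
  fixes X :: "(complex ^ 'k) set"
  assumes "open X" "closure X = UNIV"
    and pos: "\<And>p \<epsilon>. p \<notin> X \<Longrightarrow> 0 < \<epsilon> \<Longrightarrow> 0 < measure lebesgue (ball p \<epsilon> - X)"
    and "p \<in> frontier X"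
  shows "full_hausdorff_dim_at (frontier X) p"
  unfolding full_hausdorff_dim_at_def
proof (intro allI impI)
  fix \<epsilon> :: real assume "0 < \<epsilon>"
  have fr: "frontier X = - X" using assms(1,2) by (auto simp: frontier_def interior_open)
  have eq: "frontier X \<inter> ball p \<epsilon> = ball p \<epsilon> - X" by (auto simp: fr)
  have borel: "ball p \<epsilon> - X \<in> sets borel" using assms(1) by auto
  have "emeasure lborel (ball p \<epsilon> - X) \<noteq> 0"
    using pos[of p \<epsilon>] assms(4) \<open>0 < \<epsilon>\<close> borel by (auto simp: fr measure_def)
  then have "hausdorff_dim (ball p \<epsilon> - X) = ereal (real DIM(complex ^ 'k))"
    using borel by (intro hausdorff_dim_eq_DIM) (auto intro: bounded_subset[OF bounded_ball])
  then show "hausdorff_dim (frontier X \<inter> ball p \<epsilon>) = ereal (2 * real CARD('k))"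
    by (simp add: eq mult.commute)
qed

theorem theorem1p7:
  fixes S :: "nat \<Rightarrow> complex ^ 'k \<Rightarrow> complex ^ 'k"
  assumes "CARD('k) \<ge> 2"
    and "\<And>n. S n \<in> Aut0"
    and "uniform_upper_bound S"
  shows "\<exists>\<Phi> :: complex ^ 'k \<Rightarrow> complex ^ 'k.
    biholomorphism \<Phi> (basin S) (\<Phi> ` basin S) \<and>
    (\<forall>p \<in> frontier (\<Phi> ` basin S). full_hausdorff_dim_at (frontier (\<Phi> ` basin S)) p)"
proof -
  have "automorphism (S n)" for n using assms(2)[of n] by (simp add: Aut0_def)
  then obtain G where G: "\<And>n. automorphism (G n)"
      "\<And>n. G n -` polydisc 2 \<subseteq> interior (G (Suc n) -` polydisc 1)"
      "basin S = (\<Union>n. G n -` polydisc 1)"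
    using basin_eq_exhaustion[of S] assms(3) by blast
  obtain \<Phi> where \<Phi>: "biholomorphism \<Phi> (basin S) (\<Phi> ` basin S)" "closure (\<Phi> ` basin S) = UNIV"
      "\<And>p \<epsilon>. p \<notin> \<Phi> ` basin S \<Longrightarrow> 0 < \<epsilon> \<Longrightarrow> 0 < measure lebesgue (ball p \<epsilon> - \<Phi> ` basin S)"
    using biholomorphism_onto_dense_set[of G, OF assms(1) G(1,2)] unfolding G(3) by blast
  have "open (\<Phi> ` basin S)" using \<Phi>(1) by (simp add: biholomorphism_def)
  then show ?thesis
    using \<Phi> full_hausdorff_dim_at_frontier[of "\<Phi> ` basin S"] by blast
qed

end
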